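(* Let $A\subset\mathbb{R}^2$ be a domain whose boundary is a rectifiable curve, and let $\varepsilon$ be the real number defined by $|\partial A|^2=(16+\varepsilon)|A|$. Then the equality $$\inf_{S} d_\infty(A,S)^2=\frac{\varepsilon\,|A|}{64},$$ where $S$ runs over all squares, holds if and only if, up to homothety and $L^1$ isometry, $A$ is one of the following: 1. a rectangle $R_\alpha$ with side lengths $1-2\alpha$ and $1+2\alpha$, for some $0\leqslant\alpha<1/2$; 2. a set $S'_\delta$, for some $0\leqslant\delta<1/2$, where $S'_\delta$ is the closed set obtained from the unit square by deleting a $2\delta\times2\delta$ square at one corner, i.e. $S'_\delta=[0,1]^2\setminus\big((1-2\delta,1]\times(1-2\delta,1]\big)$.
   Context: The plane $\mathbb{R}^2$ is endowed with the $L^1$ metric $|(x_1,x_2)-(y_1,y_2)|=|x_1-y_1|+|x_2-y_2|$. A *domain* is the closure of the bounded connected component of the complement of a Jordan curve in $\mathbb{R}^2$; $\partial A$ denotes the boundary of $A$. For a measurable set $A$, $|A|$ is its Lebesgue measure; for a rectifiable curve $\gamma$, $|\gamma|$ is its length with respect to the $L^1$ metric; in particular $|\partial A|$ is the $L^1$ length of the Jordan curve $\partial A$. All squares and rectangles (taken as full closed sets) have their sides parallel to the coordinate axes. For $\lambda\geqslant 0$, $B_\infty(\lambda)=[-\lambda,\lambda]^2$. For compact sets $A,B\subset\mathbb{R}^2$, $d_\infty(A,B)=\inf\{\lambda\geqslant 0 : A\subset B+B_\infty(\lambda)\text{ and }B\subset A+B_\infty(\lambda)\}$ (Minkowski sums).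 *)

theory Defs
  imports "HOL-Analysis.Analysis"
begin

definition l1_dist :: "real \<times> real \<Rightarrow> real \<times> real \<Rightarrow> real"
  where "l1_dist x y = \<bar>fst x - fst y\<bar> + \<bar>snd x - snd y\<bar>"

definition jordan_curve :: "(real \<Rightarrow> real \<times> real) \<Rightarrow> bool"
  where "jordan_curve \<gamma> \<longleftrightarrow> simple_path \<gamma> \<and> pathfinish \<gamma> = pathstart \<gamma>"

definition is_domain :: "(real \<times> real) set \<Rightarrow> bool"
  where "is_domain A \<longleftrightarrow>
    (\<exists>\<gamma> C. jordan_curve \<gamma> \<and> C \<in> components (- path_image \<gamma>) \<and> bounded C \<and> A = closure C)"

text \<open>Lengths of the polygons inscribed in a curve parametrised by \<open>{0..1}\<close>; the points
  \<open>t 0 \<le> \<dots> \<le> t n\<close> need not include the endpoints, which does not affect the supremum.\<close>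

definition l1_inscribed_lengths :: "(real \<Rightarrow> real \<times> real) \<Rightarrow> real set"
  where "l1_inscribed_lengths \<gamma> =
    {\<Sum>i<n. l1_dist (\<gamma> (t i)) (\<gamma> (t (Suc i))) | (n::nat) (t::nat \<Rightarrow> real).
       mono_on {..n} t \<and> t ` {..n} \<subseteq> {0..1}}"

definition l1_rectifiable :: "(real \<Rightarrow> real \<times> real) \<Rightarrow> bool"
  where "l1_rectifiable \<gamma> \<longleftrightarrow> path \<gamma> \<and> bdd_above (l1_inscribed_lengths \<gamma>)"

text \<open>Only meaningful for rectifiable curves, as the supremum is taken in the reals.\<close>

definition l1_length :: "(real \<Rightarrow> real \<times> real) \<Rightarrow> real"
  where "l1_length \<gamma> = Sup (l1_inscribed_lengths \<gamma>)"

definition B_inf :: "real \<Rightarrow> (real \<times> real) set"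
  where "B_inf l = {-l..l} \<times> {-l..l}"

text \<open>Here \<open>+\<close> on sets is the Minkowski sum. The distance is used for nonempty compact sets
  only, for which the infimum is over a nonempty set.\<close>

definition d_inf :: "(real \<times> real) set \<Rightarrow> (real \<times> real) set \<Rightarrow> real"
  where "d_inf A B = Inf {l. 0 \<le> l \<and> A \<subseteq> B + B_inf l \<and> B \<subseteq> A + B_inf l}"

definition is_square :: "(real \<times> real) set \<Rightarrow> bool"
  where "is_square S \<longleftrightarrow> (\<exists>a b s. 0 < s \<and> S = {a..a + s} \<times> {b..b + s})"

definition homothety :: "(real \<times> real \<Rightarrow> real \<times> real) \<Rightarrow> bool"
  where "homothety h \<longleftrightarrow> (\<exists>p r. r \<noteq> 0 \<and> h = (\<lambda>x. p + r *\<^sub>R (x - p)))"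

definition l1_isometry :: "(real \<times> real \<Rightarrow> real \<times> real) \<Rightarrow> bool"
  where "l1_isometry f \<longleftrightarrow> surj f \<and> (\<forall>x y. l1_dist (f x) (f y) = l1_dist x y)"

text \<open>Conjugating an \<open>L\<^sup>1\<close> isometry by a homothety yields an \<open>L\<^sup>1\<close> isometry, and translations are
  isometries, so one homothety followed by one isometry covers all compositions of the two kinds.\<close>

definition similar_to :: "(real \<times> real) set \<Rightarrow> (real \<times> real) set \<Rightarrow> bool"
  where "similar_to A M \<longleftrightarrow> (\<exists>h f. homothety h \<and> l1_isometry f \<and> A = f ` h ` M)"

definition rect_R :: "real \<Rightarrow> (real \<times> real) set"
  where "rect_R \<alpha> = {0..1 - 2 * \<alpha>} \<times> {0..1 + 2 * \<alpha>}"

definition notched_square :: "real \<Rightarrow> (real \<times> real) set"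
  where "notched_square \<delta> =
    {0..1} \<times> {0..1} - {1 - 2 * \<delta><..1} \<times> {1 - 2 * \<delta><..1}"

end

theory Submission
  imports Defs "HOL-Library.Sublist"
begin

text \<open>Write \<open>V\<close> for the area and \<open>P\<close> for the length of the boundary of \<open>A\<close>, and let \<open>l\<^sup>2\<close> be the
infimum of the squared distances to squares. Since \<open>\<epsilon> V = P\<^sup>2 - 16 V\<close>, the equality to be characterised reads
\<open>V = (P / 4)\<^sup>2 - 4 l\<^sup>2\<close>. The inequality \<open>V \<le> (P / 4)\<^sup>2 - 4 l\<^sup>2\<close> always holds, and its equality case
is read off from the proof.

Let the bounding box of \<open>A\<close> have width \<open>a\<close> and height \<open>b\<close>, say with \<open>a \<le> b\<close>. A loop through all four sides of the box has length at
least \<open>2 a + 2 b\<close>, so it suffices to bound \<open>V\<close> by \<open>((a + b) / 2)\<^sup>2 - 4 l\<^sup>2 = a b + ((b - a) / 2)\<^sup>2 - 4 l\<^sup>2\<close>.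
If \<open>b - a \<ge> 4 l\<close>, this follows from \<open>V \<le> a b\<close>. Otherwise slide a square \<open>T\<close> of side \<open>b\<close>
horizontally over the box. The square concentric with \<open>T\<close> of side \<open>b - 2 l\<close> has
distance at least \<open>l\<close> from \<open>A\<close>, although \<open>A\<close> lies in its \<open>l\<close>-neighbourhood \<open>T\<close>. Hence some point of it
has distance at least \<open>l\<close> from \<open>A\<close>, which means that \<open>T\<close> contains an open square of side \<open>2 l\<close> that misses \<open>A\<close> (\<open>exists_missed_square\<close>). If some such
square lies inside the box, then \<open>V \<le> a b - 4 l\<^sup>2\<close>. If not, each of them sticks out of the box on the
left or on the right, and by connectedness of the interval of positions some \<open>T\<close> contains one of each
kind. These two are disjoint, since otherwise they would separate the bottom of \<open>A\<close> from its top,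
and together they cut so much off the box that the inequality is strict
(\<open>missed_square_dichotomy_tall\<close>).

Equality therefore leaves two possibilities (\<open>area_bound\<close>). Either \<open>A\<close> fills its box; or the box is a
square, \<open>P\<close> is the perimeter of the box, and \<open>A\<close> is the box without a square of side \<open>2 l\<close>. In the
latter case the removed square lies in a corner: otherwise some horizontal or vertical strip meets the
boundary of \<open>A\<close> in four parallel segments, and a loop that runs through all of them is too long
(\<open>loop_length_ge_four_lines\<close>).

Conversely, for the two families a lower bound for \<open>l\<close>, the area, and an upper bound for \<open>P\<close> are
computed; with the general inequality these force equality. The bound for \<open>P\<close>
(\<open>simple_path_grid_length_le\<close>) has to hold for every simple parametrisation of the
boundary; it holds because disjoint arcs have disjoint traces on the sides. Similarity is made
explicit by showing that the isometries of the \<open>L\<^sup>1\<close> plane are the signed coordinate permutations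
followed by translations (\<open>l1_isometry_cases\<close>).\<close>


section \<open>Variation along finite sets of times\<close>


fun list_variation :: "(real \<Rightarrow> real) \<Rightarrow> real list \<Rightarrow> real" where
  "list_variation g (x # y # zs) = \<bar>g x - g y\<bar> + list_variation g (y # zs)"
| "list_variation g _ = 0"

text \<open>Inserting a point increases the sum by the triangle inequality. The common head \<open>x\<close> lets the
induction compare two lists whose first entries differ.\<close>

lemma list_variation_subseq_Cons: "subseq xs ys \<Longrightarrow> list_variation g (x # xs) \<le> list_variation g (x # ys)"
proof (induction arbitrary: x rule: list_emb.induct)
  case (list_emb_Nil ys)
  show ?case by (induction ys arbitrary: x) (simp_all add: add_nonneg_nonneg)
next
  case (list_emb_Cons xs ys y)
  have "list_variation g (x # xs) \<le> \<bar>g x - g y\<bar> + list_variation g (y # xs)"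
    by (cases xs) auto
  with list_emb_Cons.IH[of y] show ?case by simp
next
  case (list_emb_Cons2 x' y xs ys)
  then show ?case by simp
qed

lemma list_variation_subseq: "subseq xs ys \<Longrightarrow> list_variation g xs \<le> list_variation g ys"
proof (induction rule: list_emb.induct)
  case (list_emb_Nil ys)
  show ?case using list_variation_subseq_Cons[of "[]" "tl ys" g "hd ys"] by (cases ys) auto
next
  case (list_emb_Cons xs ys y)
  have "list_variation g ys \<le> list_variation g (y # ys)" by (cases ys) auto
  with list_emb_Cons show ?case by simp
next
  case (list_emb_Cons2 x y xs ys)
  then show ?case by (simp add: list_variation_subseq_Cons)
qed

definition variation_on :: "(real \<Rightarrow> real) \<Rightarrow> real set \<Rightarrow> real" where
  "variation_on g F = list_variation g (sorted_list_of_set F)"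

lemma list_variation_le_variation_on:
  assumes "finite F" "sorted_wrt (<) xs" "set xs \<subseteq> F"
  shows "list_variation g xs \<le> variation_on g F"
  unfolding variation_on_def using assms by (intro list_variation_subseq sorted_subset_imp_subseq) auto

lemma list_variation_nth: "list_variation g xs = (\<Sum>i<length xs - 1. \<bar>g (xs ! i) - g (xs ! Suc i)\<bar>)"
  by (induction g xs rule: list_variation.induct) (auto simp: sum.lessThan_Suc_shift simp del: sum.lessThan_Suc)

text \<open>The length bounds the variations of both coordinates along the \<^emph>\<open>same\<close> finite set of times, so that
estimates for the two coordinates can be added.\<close>

lemma l1_length_ge_variation:
  assumes "l1_rectifiable \<gamma>" "finite F" "F \<subseteq> {0..1}" "F \<noteq> {}"
  shows "variation_on (\<lambda>t. fst (\<gamma> t)) F + variation_on (\<lambda>t. snd (\<gamma> t)) F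
         \<le> l1_length \<gamma>"
proof -
  define xs where "xs = sorted_list_of_set F"
  have xs: "sorted xs" "set xs = F" "xs \<noteq> []" using assms by (auto simp: xs_def)
  have "mono_on {..length xs - 1} ((!) xs)"
  proof (rule mono_onI)
    fix i j assume "i \<in> {..length xs - 1}" "j \<in> {..length xs - 1}" "i \<le> j"
    then show "xs ! i \<le> xs ! j"
      using xs by (intro sorted_nth_mono) (auto simp: Suc_le_eq[symmetric] Suc_diff_le le_diff_conv, cases xs, auto)
  qed
  moreover have "(!) xs ` {..length xs - 1} \<subseteq> {0..1}"
  proof -
    have "xs ! i \<in> set xs" if "i \<le> length xs - 1" for i
      using that xs(3) by (intro nth_mem) (cases xs, auto)
    then show ?thesis using xs(2) assms(3) by blast
  qed
  ultimately have "(\<Sum>i<length xs - 1. l1_dist (\<gamma> (xs ! i)) (\<gamma> (xs ! Suc i))) \<in> l1_inscribed_lengths \<gamma>"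
    unfolding l1_inscribed_lengths_def by blast
  then have "(\<Sum>i<length xs - 1. l1_dist (\<gamma> (xs ! i)) (\<gamma> (xs ! Suc i))) \<le> l1_length \<gamma>"
    unfolding l1_length_def using assms(1) by (intro cSup_upper) (auto simp: l1_rectifiable_def)
  then show ?thesis
    by (simp add: variation_on_def[of _ F] list_variation_nth l1_dist_def sum.distrib xs_def)
qed

text \<open>A loop travels from \<open>s\<close> to \<open>t\<close> and back.\<close>

lemma loop_variation_ge:
  assumes "finite F" "{0, 1, s, t} \<subseteq> F" "F \<subseteq> {0..1}" "g 0 = g 1"
  shows "2 * (g t - g s) \<le> variation_on g F"
proof -
  have *: "2 * \<bar>g s - g t\<bar> \<le> variation_on g F" if "{0, 1, s, t} \<subseteq> F" "s \<le> t" for s t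
  proof -
    have st: "0 \<le> s" "t \<le> 1" using that assms by auto
    have "2 * \<bar>g s - g t\<bar> \<le> variation_on g {0, s, t, 1}"
    proof (cases "s = t")
      case False
      have "s = 0 \<or> 0 < s" "t = 1 \<or> t < 1" using st that by auto
      then have "variation_on g {0, s, t, 1} = \<bar>g 0 - g s\<bar> + \<bar>g s - g t\<bar> + \<bar>g t - g 1\<bar>"
        using st that False by (auto simp: variation_on_def)
      moreover have "\<bar>g s - g t\<bar> \<le> \<bar>g 0 - g s\<bar> + \<bar>g t - g 1\<bar>" using assms(4) by linarith
      ultimately show ?thesis by simp
    qed (simp add: variation_on_def list_variation_nth sum_nonneg)
    also have "\<dots> \<le> variation_on g F"
      unfolding variation_on_def[of g "{0, s, t, 1}"]
    proof (rule list_variation_le_variation_on)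
      show "set (sorted_list_of_set {0, s, t, 1}) \<subseteq> F"
        using that by (subst set_sorted_list_of_set) auto
    qed (use assms(1) in \<open>auto simp only: strict_sorted_list_of_set\<close>)
    finally show ?thesis .
  qed
  have "2 * \<bar>g s - g t\<bar> \<le> variation_on g F"
    using *[of s t] *[of t s] assms(2) by (cases "s \<le> t") (auto simp: abs_minus_commute insert_commute)
  then show ?thesis by argo
qed

section \<open>Lower bounds for the length of a loop\<close>

lemma abs_diff_split:
  fixes a b :: real
  assumes "h1 \<le> h2"
  shows "\<bar>a - b\<bar> = \<bar>min a h1 - min b h1\<bar> + \<bar>max h1 (min a h2) - max h1 (min b h2)\<bar>
                     + \<bar>max a h2 - max b h2\<bar>"
  using assms by (smt (verit) max_def min_def)

text \<open>Cutting the range at two heights splits the variation into the parts below, between and above them,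
which can then be estimated separately.\<close>

lemma variation_on_split:
  assumes "h1 \<le> h2"
  shows "variation_on g F = variation_on (\<lambda>t. min (g t) h1) F + variation_on (\<lambda>t. max h1 (min (g t) h2)) F
                     + variation_on (\<lambda>t. max (g t) h2) F"
  unfolding variation_on_def list_variation_nth sum.distrib[symmetric] by (intro sum.cong refl abs_diff_split assms)

lemma loop_length_ge:
  assumes "l1_rectifiable \<gamma>" "\<gamma> 0 = \<gamma> 1"
    and "sx \<in> {0..1}" "tx \<in> {0..1}" "fst (\<gamma> sx) = x0" "fst (\<gamma> tx) = x1"
    and "sy \<in> {0..1}" "ty \<in> {0..1}" "snd (\<gamma> sy) = y0" "snd (\<gamma> ty) = y1"
  shows "2 * (x1 - x0) + 2 * (y1 - y0) \<le> l1_length \<gamma>"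
proof -
  define F where "F = {0, 1, sx, tx, sy, ty}"
  have F: "finite F" "F \<subseteq> {0..1}" "F \<noteq> {}" using assms by (auto simp: F_def)
  have "2 * (fst (\<gamma> tx) - fst (\<gamma> sx)) \<le> variation_on (\<lambda>t. fst (\<gamma> t)) F"
    by (rule loop_variation_ge) (use F assms in \<open>auto simp: F_def\<close>)
  moreover have "2 * (snd (\<gamma> ty) - snd (\<gamma> sy)) \<le> variation_on (\<lambda>t. snd (\<gamma> t)) F"
    by (rule loop_variation_ge) (use F assms in \<open>auto simp: F_def\<close>)
  ultimately show ?thesis using l1_length_ge_variation[OF assms(1) F(1,2,3)] unfolding assms by argo
qed

text \<open>Below \<open>h1\<close> and above \<open>h2\<close> the loop contributes what every loop does. Inside the band it makes
six half crossings, which is one crossing of the band more than the two that every loop makes.\<close>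

lemma four_crossings_variation_ge:
  assumes F: "finite F" "{0, 1, s, t, u0, v0, u1, v1, u2, v2, u3} \<subseteq> F" "F \<subseteq> {0..1}"
    and "g 0 = g 1" "g s = y0" "g t = y1" "y0 \<le> h1" "h1 \<le> h2" "h2 \<le> y1"
    and ord: "u0 < v0" "v0 < u1" "u1 < v1" "v1 < u2" "u2 < v2" "v2 < u3"
    and mid: "\<And>u. u \<in> {u0, u1, u2, u3} \<Longrightarrow> g u = (h1 + h2) / 2"
    and out: "\<And>v. v \<in> {v0, v1, v2} \<Longrightarrow> g v \<le> h1 \<or> h2 \<le> g v"
  shows "2 * (y1 - y0) + (h2 - h1) \<le> variation_on g F"
proof -
  let ?c = "\<lambda>t. max h1 (min (g t) h2)"
  have lo: "2 * (min (g t) h1 - min (g s) h1) \<le> variation_on (\<lambda>t. min (g t) h1) F"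
    by (rule loop_variation_ge) (use assms in auto)
  have hi: "2 * (max (g t) h2 - max (g s) h2) \<le> variation_on (\<lambda>t. max (g t) h2) F"
    by (rule loop_variation_ge) (use assms in auto)
  have mid': "?c u = (h1 + h2) / 2" if "u \<in> {u0, u1, u2, u3}" for u
    using mid[OF that] assms(8) by (simp add: min_def max_def field_simps)
  have out': "\<bar>?c v - (h1 + h2) / 2\<bar> = (h2 - h1) / 2" if "v \<in> {v0, v1, v2}" for v
    using out[OF that] assms(8) by (auto simp: min_def max_def field_simps abs_if)
  have "list_variation ?c [u0, v0, u1, v1, u2, v2, u3] \<le> variation_on ?c F"
    by (rule list_variation_le_variation_on) (use F ord in auto)
  moreover have "list_variation ?c [u0, v0, u1, v1, u2, v2, u3] = 3 * (h2 - h1)"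
  proof -
    have "\<bar>?c u - ?c v\<bar> = (h2 - h1) / 2 \<and> \<bar>?c v - ?c u\<bar> = (h2 - h1) / 2"
      if "u \<in> {u0, u1, u2, u3}" "v \<in> {v0, v1, v2}" for u v
      unfolding mid'[OF that(1)] using out'[OF that(2)] by linarith
    then show ?thesis by (simp only: list_variation.simps insert_iff simp_thms)
  qed
  moreover have "min (g s) h1 = y0" "min (g t) h1 = h1" "max (g s) h2 = h2" "max (g t) h2 = y1"
    using assms(4-9) by (auto simp: min_def max_def)
  ultimately show ?thesis using variation_on_split[OF assms(8), of g F] lo hi by argo
qed

text \<open>Inside the band \<open>h1 < f2 < h2\<close> the loop lives on four parallel lines. Between two visits to the middle
of different lines it has to leave the band, because as long as it stays inside, \<open>f1\<close> takes finitely
many values along it and is therefore constant. The coordinates \<open>f1\<close> and \<open>f2\<close> are \<open>fst\<close> and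
\<open>snd\<close> in either order, so that horizontal and vertical strips are both covered.\<close>

lemma loop_length_ge_four_lines:
  fixes f1 f2 :: "real \<times> real \<Rightarrow> real"
  assumes rect: "l1_rectifiable \<gamma>" and loop: "\<gamma> 0 = \<gamma> 1"
    and coord: "(f1 = fst \<and> f2 = snd) \<or> (f1 = snd \<and> f2 = fst)"
    and "sx \<in> {0..1}" "tx \<in> {0..1}" "f1 (\<gamma> sx) = x0" "f1 (\<gamma> tx) = x1"
    and "sy \<in> {0..1}" "ty \<in> {0..1}" "f2 (\<gamma> sy) = y0" "f2 (\<gamma> ty) = y1"
    and "y0 \<le> h1" "h1 < h2" "h2 \<le> y1"
    and X: "finite X" "card X = 4"
    and on: "\<And>x. x \<in> X \<Longrightarrow> \<exists>p\<in>path_image \<gamma>. f1 p = x \<and> f2 p = (h1 + h2) / 2"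
    and lines: "\<And>p. p \<in> path_image \<gamma> \<Longrightarrow> h1 < f2 p \<Longrightarrow> f2 p < h2 \<Longrightarrow> f1 p \<in> X"
  shows "2 * (x1 - x0) + 2 * (y1 - y0) < l1_length \<gamma>"
proof -
  have path: "path \<gamma>" using rect by (simp add: l1_rectifiable_def)
  have cont: "continuous_on {0..1} (\<lambda>t. f1 (\<gamma> t))"
    using coord path unfolding path_def by (auto intro!: continuous_intros)
  have "\<forall>x\<in>X. \<exists>t\<in>{0..1}. f1 (\<gamma> t) = x \<and> f2 (\<gamma> t) = (h1 + h2) / 2"
    using on unfolding path_image_def by blast
  then obtain \<tau> where \<tau>: "\<And>x. x \<in> X \<Longrightarrow> \<tau> x \<in> {0..1} \<and> f1 (\<gamma> (\<tau> x)) = x \<and> f2 (\<gamma> (\<tau> x)) = (h1 + h2) / 2"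
    by metis
  have "inj_on \<tau> X" by (rule inj_onI) (metis \<tau>)
  then have card: "card (\<tau> ` X) = 4" using X by (simp add: card_image)
  define us where "us = sorted_list_of_set (\<tau> ` X)"
  have us: "sorted_wrt (<) us" "set us = \<tau> ` X" "length us = 4"
    using X card by (simp_all add: us_def)
  then obtain u0 u1 u2 u3 where us_eq: "us = [u0, u1, u2, u3]"
    by (auto simp: numeral_eq_Suc length_Suc_conv)
  have ord: "u0 < u1" "u1 < u2" "u2 < u3" using us(1) by (auto simp: us_eq)
  have u_in: "u \<in> {0..1} \<and> f2 (\<gamma> u) = (h1 + h2) / 2 \<and> u = \<tau> (f1 (\<gamma> u))"
    if "u \<in> {u0, u1, u2, u3}" for u
  proof -
    have "u \<in> \<tau> ` X" using that us(2) us_eq by auto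
    then show ?thesis using \<tau> by auto
  qed
  have leave: "\<exists>v. u < v \<and> v < u' \<and> (f2 (\<gamma> v) \<le> h1 \<or> h2 \<le> f2 (\<gamma> v))"
    if uu: "u \<in> {u0, u1, u2, u3}" "u' \<in> {u0, u1, u2, u3}" "u < u'" for u u'
  proof (rule ccontr)
    assume none: "\<not> ?thesis"
    have sub: "{u..u'} \<subseteq> {0..1}" using u_in[OF uu(1)] u_in[OF uu(2)] by auto
    have "f1 (\<gamma> v) \<in> X" if v: "v \<in> {u..u'}" for v
    proof (rule lines)
      show "\<gamma> v \<in> path_image \<gamma>" using v sub by (auto simp: path_image_def)
      have "h1 < f2 (\<gamma> v) \<and> f2 (\<gamma> v) < h2"
      proof (cases "v = u \<or> v = u'")
        case True
        then show ?thesis using u_in[OF uu(1)] u_in[OF uu(2)] \<open>h1 < h2\<close> by auto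
      next
        case False
        then have "u < v" "v < u'" using v by auto
        then show ?thesis using none by force
      qed
      then show "h1 < f2 (\<gamma> v)" "f2 (\<gamma> v) < h2" by auto
    qed
    then have "finite ((\<lambda>t. f1 (\<gamma> t)) ` {u..u'})" 
      by (intro finite_subset[OF _ X(1)]) blast
    moreover have "connected ((\<lambda>t. f1 (\<gamma> t)) ` {u..u'})"
      by (rule connected_continuous_image) (use continuous_on_subset[OF cont sub] in auto)
    ultimately obtain z where "(\<lambda>t. f1 (\<gamma> t)) ` {u..u'} \<subseteq> {z}"
      using connected_finite_iff_sing by (metis empty_subsetI subset_refl)
    then have "f1 (\<gamma> u) = z" "f1 (\<gamma> u') = z" using uu(3) by (auto simp: image_subset_iff)
    then have "f1 (\<gamma> u) = f1 (\<gamma> u')" by simp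
    then show False using u_in[OF uu(1)] u_in[OF uu(2)] uu(3) by auto
  qed
  obtain v0 where v0: "u0 < v0" "v0 < u1" "f2 (\<gamma> v0) \<le> h1 \<or> h2 \<le> f2 (\<gamma> v0)"
    using leave[of u0 u1] ord by auto
  obtain v1 where v1: "u1 < v1" "v1 < u2" "f2 (\<gamma> v1) \<le> h1 \<or> h2 \<le> f2 (\<gamma> v1)"
    using leave[of u1 u2] ord by auto
  obtain v2 where v2: "u2 < v2" "v2 < u3" "f2 (\<gamma> v2) \<le> h1 \<or> h2 \<le> f2 (\<gamma> v2)"
    using leave[of u2 u3] ord by auto
  define F where "F = {0, 1, sx, tx, sy, ty, u0, v0, u1, v1, u2, v2, u3}"
  have u01: "u \<in> {0..1}" if "u \<in> {u0, u1, u2, u3}" for u using u_in[OF that] by blast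
  have F: "finite F" "F \<subseteq> {0..1}" "F \<noteq> {}"
    using assms(4-11) u01[of u0] u01[of u1] u01[of u2] u01[of u3] v0 v1 v2 by (auto simp: F_def)
  have x: "2 * (f1 (\<gamma> tx) - f1 (\<gamma> sx)) \<le> variation_on (\<lambda>t. f1 (\<gamma> t)) F"
    by (rule loop_variation_ge) (use F loop in \<open>auto simp: F_def\<close>)
  have y: "2 * (y1 - y0) + (h2 - h1) \<le> variation_on (\<lambda>t. f2 (\<gamma> t)) F"
  proof (rule four_crossings_variation_ge)
    show "f2 (\<gamma> u) = (h1 + h2) / 2" if "u \<in> {u0, u1, u2, u3}" for u using u_in[OF that] by blast
    show "f2 (\<gamma> v) \<le> h1 \<or> h2 \<le> f2 (\<gamma> v)" if "v \<in> {v0, v1, v2}" for v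
      using that v0 v1 v2 by auto
    show "{0, 1, sy, ty, u0, v0, u1, v1, u2, v2, u3} \<subseteq> F" by (auto simp: F_def)
  qed (use F v0 v1 v2 loop assms in auto)
  have "variation_on (\<lambda>t. f1 (\<gamma> t)) F + variation_on (\<lambda>t. f2 (\<gamma> t)) F
         \<le> l1_length \<gamma>"
    using l1_length_ge_variation[OF rect F(1,2,3)] coord by (auto simp: add.commute)
  then show ?thesis using x y \<open>h1 < h2\<close> unfolding assms(6,7) by argo
qed

section \<open>Squares missed by a set\<close>

text \<open>The open square with centre \<open>(x, y)\<close> and half side \<open>l\<close> does not meet \<open>A\<close>.\<close>

definition misses :: "(real \<times> real) set \<Rightarrow> real \<Rightarrow> real \<Rightarrow> real \<Rightarrow> bool" where
  "misses A l x y \<longleftrightarrow> (\<forall>p\<in>A. l \<le> \<bar>fst p - x\<bar> \<or> l \<le> \<bar>snd p - y\<bar>)"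

definition tight_box :: "(real \<times> real) set \<Rightarrow> real \<Rightarrow> real \<Rightarrow> real \<Rightarrow> real \<Rightarrow> bool" where
  "tight_box A x0 x1 y0 y1 \<longleftrightarrow> A \<subseteq> {x0..x1} \<times> {y0..y1} \<and>
     (\<exists>p\<in>A. fst p = x0) \<and> (\<exists>p\<in>A. fst p = x1) \<and> (\<exists>p\<in>A. snd p = y0) \<and> (\<exists>p\<in>A. snd p = y1)"

text \<open>For nonempty compact \<open>A\<close> this amounts to \<open>l \<le> d_inf A S\<close> for all squares \<open>S\<close>. Phrasing it with
radii below \<open>l\<close> avoids the question whether the infima are attained.\<close>

definition far_from_squares :: "(real \<times> real) set \<Rightarrow> real \<Rightarrow> bool" where
  "far_from_squares A l \<longleftrightarrow>
     (\<forall>l' S. 0 \<le> l' \<and> l' < l \<and> is_square S \<longrightarrow> \<not> (A \<subseteq> S + B_inf l' \<and> S \<subseteq> A + B_inf l'))"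

lemma mem_plus_B_inf:
  "p \<in> X + B_inf l \<longleftrightarrow> (\<exists>q\<in>X. \<bar>fst p - fst q\<bar> \<le> l \<and> \<bar>snd p - snd q\<bar> \<le> l)"
proof
  assume "p \<in> X + B_inf l"
  then obtain q r where "q \<in> X" "r \<in> B_inf l" "p = q + r" by (auto elim: set_plus_elim)
  then show "\<exists>q\<in>X. \<bar>fst p - fst q\<bar> \<le> l \<and> \<bar>snd p - snd q\<bar> \<le> l"
    by (intro bexI[of _ q]) (auto simp: B_inf_def)
next
  assume "\<exists>q\<in>X. \<bar>fst p - fst q\<bar> \<le> l \<and> \<bar>snd p - snd q\<bar> \<le> l"
  then obtain q where q: "q \<in> X" "\<bar>fst p - fst q\<bar> \<le> l" "\<bar>snd p - snd q\<bar> \<le> l" by blast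
  have "q + (p - q) \<in> X + B_inf l"
    by (rule set_plus_intro) (use q in \<open>auto simp: B_inf_def mem_Times_iff\<close>)
  then show "p \<in> X + B_inf l" by simp
qed

lemma clamp_near:
  fixes l s :: real
  assumes "0 \<le> l" "0 \<le> s" "a - l \<le> u" "u \<le> a + s + l"
  shows "\<exists>v\<in>{a..a + s}. \<bar>u - v\<bar> \<le> l"
  using assms by (intro bexI[of _ "max a (min u (a + s))"]) auto

lemma mem_square_plus_B_inf:
  assumes "0 \<le> l" "0 \<le> s" "a - l \<le> fst p" "fst p \<le> a + s + l" "b - l \<le> snd p" "snd p \<le> b + s + l"
  shows "p \<in> {a..a + s} \<times> {b..b + s} + B_inf l"
proof -
  obtain v w where "v \<in> {a..a + s}" "w \<in> {b..b + s}" "\<bar>fst p - v\<bar> \<le> l" "\<bar>snd p - w\<bar> \<le> l"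
    using clamp_near[of l s a "fst p"] clamp_near[of l s b "snd p"] assms by blast
  then show ?thesis unfolding mem_plus_B_inf by (intro bexI[of _ "(v, w)"]) auto
qed

text \<open>A tiny square in the middle of the box is within about half the longer side of \<open>A\<close>.\<close>

lemma far_radius_le:
  assumes tb: "tight_box A x0 x1 y0 y1" and far: "far_from_squares A l" "0 < l"
    and ab: "x1 - x0 \<le> y1 - y0"
  shows "2 * l \<le> y1 - y0"
proof (rule ccontr)
  assume neg: "\<not> 2 * l \<le> y1 - y0"
  define b where "b = y1 - y0"
  define s where "s = l - b / 2"
  obtain p where p: "p \<in> A" using tb by (auto simp: tight_box_def)
  have inA: "x0 \<le> fst q \<and> fst q \<le> x1 \<and> y0 \<le> snd q \<and> snd q \<le> y1" if "q \<in> A" for q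
    using tb that by (auto simp: tight_box_def)
  have s: "0 < s" using neg by (simp add: s_def b_def)
  have b: "0 \<le> b" using inA[OF p] by (simp add: b_def)
  let ?a = "(x0 + x1) / 2 - s / 2" and ?b = "(y0 + y1) / 2 - s / 2" and ?l = "b / 2 + s / 2"
  let ?S = "{?a..?a + s} \<times> {?b..?b + s}"
  have "is_square ?S" using s unfolding is_square_def by blast
  moreover have "0 \<le> ?l" using s b by simp
  moreover have "?l < l" using neg unfolding s_def b_def by argo
  moreover have "A \<subseteq> ?S + B_inf ?l"
  proof
    fix q assume "q \<in> A"
    from inA[OF this] show "q \<in> ?S + B_inf ?l"
      using s b ab by (intro mem_square_plus_B_inf) (auto simp: b_def field_simps)
  qed
  moreover have "?S \<subseteq> A + B_inf ?l"
  proof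
    fix q assume "q \<in> ?S"
    then show "q \<in> A + B_inf ?l" unfolding mem_plus_B_inf
      using p inA[OF p] ab by (intro bexI[of _ p]) (auto simp: b_def abs_if field_simps)
  qed
  ultimately show False using far by (auto simp: far_from_squares_def)
qed

text \<open>For a radius \<open>r < l\<close>, the square of side \<open>y1 - y0 - 2 r\<close> in the middle of \<open>T = [c, c + (y1 - y0)] \<times> [y0, y1]\<close>
covers \<open>A\<close> up to \<open>r\<close>, so one of its points is farther than \<open>r\<close> from \<open>A\<close>. A limit point of
these points for \<open>r \<rightarrow> l\<close> is the centre of the missed square, which lies in \<open>T\<close>.\<close>

lemma exists_missed_square:
  assumes tb: "tight_box A x0 x1 y0 y1" and far: "far_from_squares A l" "0 < l"
    and ab: "x1 - x0 \<le> y1 - y0" and c: "x1 - (y1 - y0) \<le> c" "c \<le> x0"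
  shows "\<exists>x y. c + l \<le> x \<and> x \<le> c + (y1 - y0) - l \<and> y0 + l \<le> y \<and> y \<le> y1 - l \<and> misses A l x y"
proof -
  define b where "b = y1 - y0"
  have bl: "2 * l \<le> b" using far_radius_le[OF tb far ab] by (simp add: b_def)
  have inA: "x0 \<le> fst q \<and> fst q \<le> x1 \<and> y0 \<le> snd q \<and> snd q \<le> y1" if "q \<in> A" for q
    using tb that by (auto simp: tight_box_def)
  \<comment> \<open>Starting the sequence at radius 0 keeps all radii nonnegative.\<close>
  define r where "r n = l - l / real (Suc n)" for n
  have r0: "0 \<le> r n" "r n < l" for n
    using \<open>0 < l\<close> by (auto simp: r_def field_simps)
  have r_lim: "r \<longlonglongrightarrow> l"
  proof -
    have "(\<lambda>n. l - l * (1 / real (Suc n))) \<longlonglongrightarrow> l - l * 0"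
      using LIMSEQ_inverse_real_of_nat by (intro tendsto_intros) (simp add: inverse_eq_divide)
    then show ?thesis by (simp add: r_def[abs_def])
  qed
  have "\<exists>q. c + r n \<le> fst q \<and> fst q \<le> c + b - r n \<and> y0 + r n \<le> snd q \<and> snd q \<le> y1 - r n \<and>
            (\<forall>p\<in>A. r n < \<bar>fst p - fst q\<bar> \<or> r n < \<bar>snd p - snd q\<bar>)" for n
  proof -
    define s where "s = b - 2 * r n"
    have s: "0 < s" using r0[of n] bl by (simp add: s_def)
    let ?S = "{c + r n..c + r n + s} \<times> {y0 + r n..y0 + r n + s}"
    have "is_square ?S" using s unfolding is_square_def by blast
    moreover have "A \<subseteq> ?S + B_inf (r n)"
    proof
      fix q assume "q \<in> A"
      from inA[OF this] show "q \<in> ?S + B_inf (r n)"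
        using s r0[of n] c by (intro mem_square_plus_B_inf) (auto simp: b_def s_def)
    qed
    ultimately have "\<not> ?S \<subseteq> A + B_inf (r n)"
      using far r0[of n] by (auto simp: far_from_squares_def)
    then obtain q where q: "q \<in> ?S" "q \<notin> A + B_inf (r n)" by blast
    then show ?thesis
      by (intro exI[of _ q]) (auto simp: mem_plus_B_inf s_def b_def not_le abs_minus_commute)
  qed
  then obtain q where q: "\<And>n. c + r n \<le> fst (q n) \<and> fst (q n) \<le> c + b - r n \<and> y0 + r n \<le> snd (q n) \<and> snd (q n) \<le> y1 - r n"
      "\<And>n p. p \<in> A \<Longrightarrow> r n < \<bar>fst p - fst (q n)\<bar> \<or> r n < \<bar>snd p - snd (q n)\<bar>"
    by metis
  have "q n \<in> cbox (c, y0) (c + b, y1)" for n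
  proof -
    have "fst (q n) \<in> {c..c + b}" "snd (q n) \<in> {y0..y1}" using q(1)[of n] r0(1)[of n] by auto
    then show ?thesis by (cases "q n") (auto simp: cbox_Pair_eq)
  qed
  then obtain z k where z: "strict_mono k" "(q \<circ> k) \<longlonglongrightarrow> z"
    using compact_cbox[of "(c, y0)" "(c + b, y1)"] unfolding compact_def by metis
  have f: "(\<lambda>n. fst (q (k n))) \<longlonglongrightarrow> fst z" and s: "(\<lambda>n. snd (q (k n))) \<longlonglongrightarrow> snd z"
    using tendsto_fst[OF z(2)] tendsto_snd[OF z(2)] by (simp_all add: o_def)
  have rk: "(\<lambda>n. r (k n)) \<longlonglongrightarrow> l"
    using LIMSEQ_subseq_LIMSEQ[OF r_lim z(1)] by (simp add: o_def)
  have "c + l \<le> fst z" by (rule LIMSEQ_le[OF tendsto_add[OF tendsto_const rk] f]) (use q(1) in auto)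
  moreover have "fst z \<le> c + b - l"
    by (rule LIMSEQ_le[OF f tendsto_diff[OF tendsto_const rk]]) (use q(1) in auto)
  moreover have "y0 + l \<le> snd z" by (rule LIMSEQ_le[OF tendsto_add[OF tendsto_const rk] s]) (use q(1) in auto)
  moreover have "snd z \<le> y1 - l"
    by (rule LIMSEQ_le[OF s tendsto_diff[OF tendsto_const rk]]) (use q(1) in auto)
  moreover have "misses A l (fst z) (snd z)"
    unfolding misses_def
  proof (rule ballI, rule ccontr)
    fix p assume p: "p \<in> A" "\<not> (l \<le> \<bar>fst p - fst z\<bar> \<or> l \<le> \<bar>snd p - snd z\<bar>)"
    have "(\<lambda>n. \<bar>fst p - fst (q (k n))\<bar> - r (k n)) \<longlonglongrightarrow> \<bar>fst p - fst z\<bar> - l"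
      by (intro tendsto_intros f rk)
    then have ev1: "eventually (\<lambda>n. \<bar>fst p - fst (q (k n))\<bar> - r (k n) < 0) sequentially"
      by (rule order_tendstoD) (use p in auto)
    have "(\<lambda>n. \<bar>snd p - snd (q (k n))\<bar> - r (k n)) \<longlonglongrightarrow> \<bar>snd p - snd z\<bar> - l"
      by (intro tendsto_intros s rk)
    then have ev2: "eventually (\<lambda>n. \<bar>snd p - snd (q (k n))\<bar> - r (k n) < 0) sequentially"
      by (rule order_tendstoD) (use p in auto)
    obtain n where "\<bar>fst p - fst (q (k n))\<bar> - r (k n) < 0" "\<bar>snd p - snd (q (k n))\<bar> - r (k n) < 0"
      using eventually_happens[OF eventually_conj[OF ev1 ev2]] by auto
    then show False using q(2)[OF p(1), of "k n"] by auto
  qed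
  ultimately show ?thesis unfolding b_def by blast
qed

text \<open>Two overlapping missed squares, one sticking out on the left and one on the right, form a barrier
across the box. The part of \<open>A\<close> above the barrier and the part below are relatively closed, and \<open>A\<close>
has points in both because it reaches the bottom and the top. The two squares may coincide, which
covers a single square blocking the full width.\<close>

lemma overhanging_missed_squares_disjoint:
  assumes con: "connected A" and tb: "tight_box A x0 x1 y0 y1" and "0 < l"
    and L: "misses A l xL yL" "xL - l < x0" "y0 + l \<le> yL" "yL \<le> y1 - l"
    and R: "misses A l xR yR" "x1 < xR + l" "y0 + l \<le> yR" "yR \<le> y1 - l"
    and meet: "xR - l < xL + l" "\<bar>yL - yR\<bar> < 2 * l"
  shows False
proof -
  obtain pt pb where pt: "pt \<in> A" "snd pt = y1" and pb: "pb \<in> A" "snd pb = y0"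
    using tb by (auto simp: tight_box_def)
  have inA: "x0 \<le> fst q \<and> fst q \<le> x1 \<and> y0 \<le> snd q \<and> snd q \<le> y1" if "q \<in> A" for q
    using tb that by (auto simp: tight_box_def)
  have mL: "xL + l \<le> fst q \<or> snd q \<le> yL - l \<or> yL + l \<le> snd q" if "q \<in> A" for q
    using L(1,2) inA[OF that] that by (force simp: misses_def abs_if split: if_splits)
  have mR: "fst q \<le> xR - l \<or> snd q \<le> yR - l \<or> yR + l \<le> snd q" if "q \<in> A" for q
    using R(1,2) inA[OF that] that by (force simp: misses_def abs_if split: if_splits)
  have sep: False if cl: "closed U" "closed D" and cov: "\<And>q. q \<in> A \<Longrightarrow> q \<in> U \<or> q \<in> D"
    and dis: "\<And>q. q \<in> U \<Longrightarrow> q \<notin> D" and tp: "pt \<notin> D" "pb \<notin> U" for U D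
  proof -
    have "U \<inter> D \<inter> A = {}" "A \<subseteq> U \<union> D" using dis cov by auto
    then have "U \<inter> A = {} \<or> D \<inter> A = {}"
      using con cl unfolding connected_closed by blast
    then show False using pt pb tp cov by blast
  qed
  show False
  proof (cases "yL \<le> yR")
    case True
    show False
    proof (rule sep)
      \<comment> \<open>The barrier is a staircase; the lower of the two squares is the left one here.\<close>
      let ?U = "{q. yR + l \<le> snd q \<or> fst q \<le> xR - l \<and> yL + l \<le> snd q}"
      let ?D = "{q. snd q \<le> yL - l \<or> xL + l \<le> fst q \<and> snd q \<le> yR - l}"
      show "closed ?U" "closed ?D"
        by (intro closed_Collect_disj closed_Collect_conj closed_Collect_le continuous_intros)+
      show "q \<in> ?U \<or> q \<in> ?D" if "q \<in> A" for q
        using mL[OF that] mR[OF that] meet True by auto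
      show "q \<notin> ?D" if "q \<in> ?U" for q
        using that meet True \<open>0 < l\<close> by auto
      show "pt \<notin> ?D" "pb \<notin> ?U" using pt pb L R \<open>0 < l\<close> by auto
    qed
  next
    case False
    show False
    proof (rule sep)
      let ?U = "{q. yL + l \<le> snd q \<or> xL + l \<le> fst q \<and> yR + l \<le> snd q}"
      let ?D = "{q. snd q \<le> yR - l \<or> fst q \<le> xR - l \<and> snd q \<le> yL - l}"
      show "closed ?U" "closed ?D"
        by (intro closed_Collect_disj closed_Collect_conj closed_Collect_le continuous_intros)+
      show "q \<in> ?U \<or> q \<in> ?D" if "q \<in> A" for q
        using mL[OF that] mR[OF that] meet False by auto
      show "q \<notin> ?D" if "q \<in> ?U" for q
        using that meet False \<open>0 < l\<close> by auto
      show "pt \<notin> ?D" "pb \<notin> ?U" using pt pb L R \<open>0 < l\<close> by auto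
    qed
  qed
qed

section \<open>Area lost to missed squares\<close>

lemma measure_rect:
  fixes a b c d :: real
  assumes "a \<le> b" "c \<le> d"
  shows "measure lebesgue ({a..b} \<times> {c..d}) = (b - a) * (d - c)" "{a..b} \<times> {c..d} \<in> lmeasurable"
proof -
  have eq: "{a..b} \<times> {c..d} = cbox (a, c) (b, d)" by (simp add: cbox_Pair_eq)
  show "measure lebesgue ({a..b} \<times> {c..d}) = (b - a) * (d - c)"
    unfolding eq using assms by (simp add: content_Pair)
  show "{a..b} \<times> {c..d} \<in> lmeasurable" unfolding eq by blast
qed

lemma measure_open_rect:
  fixes a b c d :: real
  assumes "a \<le> b" "c \<le> d"
  shows "measure lebesgue ({a<..<b} \<times> {c<..<d}) = (b - a) * (d - c)" "{a<..<b} \<times> {c<..<d} \<in> lmeasurable"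
proof -
  have eq: "{a<..<b} \<times> {c<..<d} = box (a, c) (b, d)" by (auto simp: box_def Basis_prod_def)
  have "measure lborel (box (a, c) (b, d)) = measure lborel (cbox (a, c) (b, d))"
    unfolding measure_lborel_cbox_eq measure_lborel_box_eq ..
  then show "measure lebesgue ({a<..<b} \<times> {c<..<d}) = (b - a) * (d - c)"
    unfolding eq using assms by (simp add: content_Pair)
  show "{a<..<b} \<times> {c<..<d} \<in> lmeasurable" unfolding eq by blast
qed

lemma measure_le_rect_minus:
  assumes A: "A \<in> lmeasurable" "A \<subseteq> B" and B: "B \<in> lmeasurable"
    and U: "U \<in> lmeasurable" "U \<subseteq> B" "U \<inter> A = {}"
  shows "measure lebesgue A \<le> measure lebesgue B - measure lebesgue U"
proof -
  have "measure lebesgue A \<le> measure lebesgue (B - U)"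
    by (rule measure_mono_fmeasurable) (use assms in auto)
  then show ?thesis using measurable_measure_Diff[of B lebesgue U] B U by auto
qed

lemma missed_square_in_box_area:
  assumes "compact A" and tb: "tight_box A x0 x1 y0 y1" and "0 \<le> l"
    and Q: "x0 + l \<le> x" "x \<le> x1 - l" "y0 + l \<le> y" "y \<le> y1 - l" "misses A l x y"
  shows "measure lebesgue A \<le> (x1 - x0) * (y1 - y0) - 4 * l\<^sup>2"
proof -
  let ?Q = "{x - l<..<x + l} \<times> {y - l<..<y + l}"
  have "measure lebesgue A \<le> measure lebesgue ({x0..x1} \<times> {y0..y1}) - measure lebesgue ?Q"
  proof (rule measure_le_rect_minus)
    show "?Q \<inter> A = {}" using Q(5) by (force simp: misses_def abs_if split: if_splits)
    show "A \<subseteq> {x0..x1} \<times> {y0..y1}" using tb by (simp add: tight_box_def)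
    show "?Q \<subseteq> {x0..x1} \<times> {y0..y1}" using Q by auto
    show "A \<in> lmeasurable" by (rule lmeasurable_compact) fact
    show "{x0..x1} \<times> {y0..y1} \<in> lmeasurable" by (rule measure_rect(2)) (use assms in auto)
    show "?Q \<in> lmeasurable" by (rule measure_open_rect(2)) (use assms in auto)
  qed
  then show ?thesis using assms by (simp add: measure_rect measure_open_rect power2_eq_square algebra_simps)
qed

text \<open>If \<open>T = [c, c + (y1 - y0)] \<times> [y0, y1]\<close>, the left square reaches at least \<open>c + 2 l - x0\<close> into the box and the
right one at least \<open>x1 - (c + (y1 - y0) - 2 l)\<close>. The sum of the two does not depend on \<open>c\<close>.\<close>

lemma two_missed_squares_area:
  assumes "compact A" and con: "connected A" and tb: "tight_box A x0 x1 y0 y1" and "0 < l"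
    and L: "misses A l xL yL" "xL - l < x0" "y0 + l \<le> yL" "yL \<le> y1 - l" "c + l \<le> xL"
    and R: "misses A l xR yR" "x1 < xR + l" "y0 + l \<le> yR" "yR \<le> y1 - l" "xR \<le> c + (y1 - y0) - l"
  shows "measure lebesgue A \<le> (x1 - x0) * (y1 - y0) - 2 * l * (4 * l - ((y1 - y0) - (x1 - x0)))"
proof -
  have x01: "x0 \<le> x1" "y0 \<le> y1" using tb by (auto simp: tight_box_def)
  have xL: "xL + l \<le> x1"
    using overhanging_missed_squares_disjoint[OF con tb \<open>0 < l\<close> L(1-4), of xL yL] L \<open>0 < l\<close> by force
  have xR: "x0 \<le> xR - l"
    using overhanging_missed_squares_disjoint[OF con tb \<open>0 < l\<close> _ _ _ _ R(1-4), of xR yR] R \<open>0 < l\<close> by force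
  \<comment> \<open>A square may lie entirely outside the box, hence the truncation at its sides.\<close>
  define w where "w = max x0 (xL + l)"
  define v where "v = min x1 (xR - l)"
  let ?L = "{x0<..<w} \<times> {yL - l<..<yL + l}" and ?R = "{v<..<x1} \<times> {yR - l<..<yR + l}"
  have disj: "?L \<inter> ?R = {}"
  proof (rule ccontr)
    assume "?L \<inter> ?R \<noteq> {}"
    then obtain a b where "a \<in> {x0<..<w}" "a \<in> {v<..<x1}" "b \<in> {yL - l<..<yL + l}" "b \<in> {yR - l<..<yR + l}"
      by blast
    then have "xR - l < xL + l" "\<bar>yL - yR\<bar> < 2 * l" by (auto simp: w_def v_def)
    then show False using overhanging_missed_squares_disjoint[OF con tb \<open>0 < l\<close> L(1-4) R(1-4)] by blast
  qed
  have meas: "?L \<in> lmeasurable" "?R \<in> lmeasurable"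
    "measure lebesgue ?L = (w - x0) * (2 * l)" "measure lebesgue ?R = (x1 - v) * (2 * l)"
    using \<open>0 < l\<close> by (auto simp: measure_open_rect w_def v_def)
  have "measure lebesgue A \<le> measure lebesgue ({x0..x1} \<times> {y0..y1}) - measure lebesgue (?L \<union> ?R)"
  proof (rule measure_le_rect_minus)
    have "?L \<inter> A = {}" using L(1,2) by (force simp: misses_def w_def abs_if split: if_splits)
    moreover have "?R \<inter> A = {}" using R(1,2) by (force simp: misses_def v_def abs_if split: if_splits)
    ultimately show "(?L \<union> ?R) \<inter> A = {}" by blast
    show "?L \<union> ?R \<subseteq> {x0..x1} \<times> {y0..y1}" using L R xL xR x01 by (auto simp: w_def v_def)
    show "?L \<union> ?R \<in> lmeasurable" using meas by blast
    show "A \<subseteq> {x0..x1} \<times> {y0..y1}" using tb by (simp add: tight_box_def)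
    show "A \<in> lmeasurable" by (rule lmeasurable_compact) fact
    show "{x0..x1} \<times> {y0..y1} \<in> lmeasurable" by (rule measure_rect(2)) (use x01 in auto)
  qed
  also have "measure lebesgue (?L \<union> ?R) = measure lebesgue ?L + measure lebesgue ?R"
    using measure_Un3[OF meas(1,2)] disj by simp
  finally have "measure lebesgue A \<le> (x1 - x0) * (y1 - y0) - 2 * l * ((w - x0) + (x1 - v))"
    using x01 by (simp add: measure_rect meas(3,4)) (simp add: algebra_simps)
  moreover have "4 * l - ((y1 - y0) - (x1 - x0)) \<le> (w - x0) + (x1 - v)"
    using L(5) R(5) by (auto simp: w_def v_def)
  then have "2 * l * (4 * l - ((y1 - y0) - (x1 - x0))) \<le> 2 * l * ((w - x0) + (x1 - v))"
    using \<open>0 < l\<close> by (intro mult_left_mono) auto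
  ultimately show ?thesis by linarith
qed

text \<open>The set of positions is the projection of a compact set of triples \<open>(c, x, y)\<close>.\<close>

lemma closed_missed_centres:
  fixes u0 u1 y0 y1 b l m1 m2 :: real
  shows "closed {c. c \<in> {u0..u1} \<and> (\<exists>x y. c + l \<le> x \<and> x \<le> c + b - l \<and> y0 + l \<le> y \<and> y \<le> y1 - l
                     \<and> misses A l x y \<and> m1 \<le> x \<and> x \<le> m2)}" (is "closed ?C")
proof -
  let ?K = "{(c, x, y). c \<in> {u0..u1} \<and> c + l \<le> x \<and> x \<le> c + b - l \<and> y0 + l \<le> y \<and> y \<le> y1 - l
                     \<and> misses A l x y \<and> m1 \<le> x \<and> x \<le> m2}"
  have "?K = cbox (u0, u0 + l, y0 + l) (u1, u1 + b - l, y1 - l) \<inter>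
      ({p. fst p + l \<le> fst (snd p)} \<inter> {p. fst (snd p) \<le> fst p + b - l} \<inter>
       {p. misses A l (fst (snd p)) (snd (snd p))} \<inter>
       {p. m1 \<le> fst (snd p)} \<inter> {p. fst (snd p) \<le> m2})"
    by (auto simp: cbox_Pair_eq)
  moreover have "closed {p :: real \<times> real \<times> real. misses A l (fst (snd p)) (snd (snd p))}"
  proof -
    have "{p :: real \<times> real \<times> real. misses A l (fst (snd p)) (snd (snd p))} =
        (\<Inter>q\<in>A. {p. l \<le> \<bar>fst q - fst (snd p)\<bar>} \<union> {p. l \<le> \<bar>snd q - snd (snd p)\<bar>})"
      unfolding misses_def by blast
    then show ?thesis
      by (auto intro!: closed_INT closed_Un closed_Collect_le continuous_intros)
  qed
  then have "closed ({p. fst p + l \<le> fst (snd p)} \<inter> {p. fst (snd p) \<le> fst p + b - l} \<inter>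
       {p. misses A l (fst (snd p)) (snd (snd p))} \<inter>
       {p. m1 \<le> fst (snd p)} \<inter> {p. fst (snd p) \<le> m2})"
    by (intro closed_Int closed_Collect_le continuous_intros)
  ultimately have "compact ?K" by (metis (lifting) compact_Int_closed compact_cbox)
  then have "closed (fst ` ?K)"
    by (intro compact_imp_closed compact_continuous_image continuous_intros)
  moreover have "?C = fst ` ?K"
  proof (intro set_eqI iffI)
    fix c assume "c \<in> ?C"
    then obtain x y where "(c, x, y) \<in> ?K" by blast
    then have "fst (c, x, y) \<in> fst ` ?K" by (rule imageI)
    then show "c \<in> fst ` ?K" by simp
  qed auto
  ultimately show ?thesis by simp
qed

text \<open>Suppose no missed square lies inside the box. Classify the positions \<open>c\<close> of \<open>T\<close> by whether it contains
a missed square with centre left, or right, of the midline of the box. Both classes are closed; at the two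
extreme positions \<open>T\<close> is flush with one side of the box, so its missed square can only stick out on the
other side. Hence some position belongs to both classes.\<close>

lemma missed_square_dichotomy_tall:
  assumes "compact A" and con: "connected A" and tb: "tight_box A x0 x1 y0 y1"
    and far: "far_from_squares A l" "0 < l"
    and ab: "x1 - x0 \<le> y1 - y0" and d: "(y1 - y0) - (x1 - x0) < 4 * l"
  shows "(\<exists>x y. x0 + l \<le> x \<and> x \<le> x1 - l \<and> y0 + l \<le> y \<and> y \<le> y1 - l \<and> misses A l x y) \<or>
    measure lebesgue A < (((x1 - x0) + (y1 - y0)) / 2)\<^sup>2 - 4 * l\<^sup>2"
proof (cases "\<exists>x y. x0 + l \<le> x \<and> x \<le> x1 - l \<and> y0 + l \<le> y \<and> y \<le> y1 - l \<and> misses A l x y")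
  case False
  define b where "b = y1 - y0"
  define P where "P c x y \<longleftrightarrow> c + l \<le> x \<and> x \<le> c + b - l \<and> y0 + l \<le> y \<and> y \<le> y1 - l \<and> misses A l x y" for c x y
  have out: "x < x0 + l \<or> x1 - l < x" if "P c x y" for c x y
    using False that unfolding P_def by (meson not_le)
  let ?I = "{x1 - b..x0}" and ?m = "(x0 + x1) / 2"
  define L where "L = {c \<in> ?I. \<exists>x y. P c x y \<and> x \<le> ?m}"
  define R where "R = {c \<in> ?I. \<exists>x y. P c x y \<and> ?m \<le> x}"
  have ex: "\<exists>x y. P c x y" if "c \<in> ?I" for c
    using exists_missed_square[OF tb far ab, of c] that unfolding P_def b_def by auto
  have "closed L"
  proof -
    have "L = {c. c \<in> ?I \<and> (\<exists>x y. c + l \<le> x \<and> x \<le> c + b - l \<and> y0 + l \<le> y \<and> y \<le> y1 - l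
                     \<and> misses A l x y \<and> x1 - b + l \<le> x \<and> x \<le> ?m)}"
      unfolding L_def P_def by (rule Collect_cong) fastforce
    then show ?thesis by (simp only: closed_missed_centres)
  qed
  moreover have "closed R"
  proof -
    have "R = {c. c \<in> ?I \<and> (\<exists>x y. c + l \<le> x \<and> x \<le> c + b - l \<and> y0 + l \<le> y \<and> y \<le> y1 - l
                     \<and> misses A l x y \<and> ?m \<le> x \<and> x \<le> x0 + b - l)}"
      unfolding R_def P_def by (rule Collect_cong) fastforce
    then show ?thesis by (simp only: closed_missed_centres)
  qed
  moreover have "?I \<subseteq> L \<union> R" unfolding L_def R_def using ex by force
  moreover have "x0 \<in> R"
  proof -
    have I: "x0 \<in> ?I" using ab by (simp add: b_def)
    then obtain x y where P: "P x0 x y" using ex by blast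
    then have "x0 + l \<le> x" "x1 - l < x" using out[OF P] by (auto simp: P_def)
    then show ?thesis using P I unfolding R_def by force
  qed
  moreover have "x1 - b \<in> L"
  proof -
    have I: "x1 - b \<in> ?I" using ab by (simp add: b_def)
    then obtain x y where P: "P (x1 - b) x y" using ex by blast
    then have "x \<le> x1 - l" "x < x0 + l" using out[OF P] by (auto simp: P_def)
    then show ?thesis using P I unfolding L_def by force
  qed
  moreover have "x0 \<in> ?I" "x1 - b \<in> ?I" using ab by (auto simp: b_def)
  moreover have "connected ?I" by simp
  ultimately have "L \<inter> R \<noteq> {}" unfolding connected_closed by blast
  then obtain c xL yL xR yR where P: "P c xL yL" "xL \<le> ?m" "P c xR yR" "?m \<le> xR"
    unfolding L_def R_def by blast
  have "xL < x0 + l" "x1 - l < xR" using out[OF P(1)] out[OF P(3)] P(2,4) by auto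
  then have "measure lebesgue A \<le> (x1 - x0) * (y1 - y0) - 2 * l * (4 * l - ((y1 - y0) - (x1 - x0)))"
    using P(1,3) unfolding P_def b_def
    by (intro two_missed_squares_area[OF assms(1) con tb far(2), of xL yL c xR yR]) auto
  also have "\<dots> = (((x1 - x0) + (y1 - y0)) / 2)\<^sup>2 - 4 * l\<^sup>2 - (((y1 - y0) - (x1 - x0)) / 2 - 2 * l)\<^sup>2"
    by (simp add: power2_eq_square field_simps)
  also have "\<dots> < (((x1 - x0) + (y1 - y0)) / 2)\<^sup>2 - 4 * l\<^sup>2"
    using d by simp
  finally show ?thesis by blast
qed blast

lemma swap_image_Times: "prod.swap ` (X \<times> Y) = Y \<times> X"
  by force

lemma measure_swap:
  fixes A :: "(real \<times> real) set"
  assumes "compact A"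
  shows "measure lebesgue (prod.swap ` A) = measure lebesgue A"
proof -
  have cs: "compact (prod.swap ` A)"
    by (intro compact_continuous_image assms continuous_on_swap)
  have "emeasure (lborel \<Otimes>\<^sub>M lborel) (prod.swap ` A)
     = emeasure (distr (lborel \<Otimes>\<^sub>M lborel) (lborel \<Otimes>\<^sub>M lborel) (\<lambda>(x, y). (y, x))) (prod.swap ` A)"
    by (subst lborel_pair.distr_pair_swap) simp
  also have "\<dots> = emeasure (lborel \<Otimes>\<^sub>M lborel) ((\<lambda>(x, y). (y, x)) -` (prod.swap ` A) \<inter> space (lborel \<Otimes>\<^sub>M lborel))"
  proof (rule emeasure_distr)
    show "prod.swap ` A \<in> sets (lborel \<Otimes>\<^sub>M lborel)"
      using cs by (simp only: lborel_prod sets_lborel borel_compact)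
  qed (rule measurable_pair_swap')
  also have "(\<lambda>(x, y). (y, x)) -` (prod.swap ` A) \<inter> space (lborel \<Otimes>\<^sub>M lborel) = A"
    by (force simp: space_pair_measure image_iff)
  finally have "emeasure lborel (prod.swap ` A) = emeasure lborel A"
    by (simp add: lborel_prod)
  then show ?thesis using assms cs by (simp add: measure_def borel_compact)
qed

lemma tight_box_swap: "tight_box A x0 x1 y0 y1 \<Longrightarrow> tight_box (prod.swap ` A) y0 y1 x0 x1"
  unfolding tight_box_def image_subset_iff bex_simps subset_iff[of A] by (auto simp: mem_Times_iff prod.swap_def)

lemma misses_swap: "misses (prod.swap ` A) l y x \<longleftrightarrow> misses A l x y"
  unfolding misses_def by auto

lemma swap_plus_B_inf: "prod.swap ` (X + B_inf l) = prod.swap ` X + B_inf l"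
proof (rule set_eqI)
  fix p
  have "p \<in> prod.swap ` (X + B_inf l) \<longleftrightarrow> prod.swap p \<in> X + B_inf l"
    by (metis image_iff swap_swap)
  then show "p \<in> prod.swap ` (X + B_inf l) \<longleftrightarrow> p \<in> prod.swap ` X + B_inf l"
    by (auto simp: mem_plus_B_inf)
qed

lemma far_from_squares_swap:
  assumes "far_from_squares A l" shows "far_from_squares (prod.swap ` A) l"
  unfolding far_from_squares_def
proof (intro allI impI notI)
  fix l' S assume l': "0 \<le> l' \<and> l' < l \<and> is_square S"
    and sub: "prod.swap ` A \<subseteq> S + B_inf l' \<and> S \<subseteq> prod.swap ` A + B_inf l'"
  have "is_square (prod.swap ` S)"
    using l' unfolding is_square_def by (metis swap_image_Times)
  moreover have "A \<subseteq> prod.swap ` S + B_inf l'"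
    using sub image_mono[of "prod.swap ` A" "S + B_inf l'" prod.swap]
    by (simp add: swap_plus_B_inf image_image)
  moreover have "prod.swap ` S \<subseteq> A + B_inf l'"
    using sub image_mono[of S "prod.swap ` A + B_inf l'" prod.swap]
    by (simp add: swap_plus_B_inf image_image)
  ultimately show False using assms l' unfolding far_from_squares_def by blast
qed

lemma missed_square_dichotomy:
  assumes "compact A" "connected A" and tb: "tight_box A x0 x1 y0 y1"
    and far: "far_from_squares A l" "0 < l" and d: "\<bar>(y1 - y0) - (x1 - x0)\<bar> < 4 * l"
  shows "(\<exists>x y. x0 + l \<le> x \<and> x \<le> x1 - l \<and> y0 + l \<le> y \<and> y \<le> y1 - l \<and> misses A l x y) \<or>
    measure lebesgue A < (((x1 - x0) + (y1 - y0)) / 2)\<^sup>2 - 4 * l\<^sup>2"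
proof (cases "x1 - x0 \<le> y1 - y0")
  case True
  then show ?thesis using missed_square_dichotomy_tall[OF assms(1-5)] d by auto
next
  case False
  let ?A = "prod.swap ` A"
  have A: "compact ?A" "connected ?A"
    using assms(1,2) by (auto intro!: compact_continuous_image connected_continuous_image continuous_on_swap)
  have "(\<exists>y x. y0 + l \<le> y \<and> y \<le> y1 - l \<and> x0 + l \<le> x \<and> x \<le> x1 - l \<and> misses ?A l y x) \<or>
    measure lebesgue ?A < (((y1 - y0) + (x1 - x0)) / 2)\<^sup>2 - 4 * l\<^sup>2"
    using False d
    by (intro missed_square_dichotomy_tall A tight_box_swap tb far_from_squares_swap far) auto
  then show ?thesis
    unfolding misses_swap measure_swap[OF assms(1)] add.commute[of "y1 - y0"] by blast
qed

text \<open>The box has area \<open>((a + b) / 2)\<^sup>2 - ((b - a) / 2)\<^sup>2\<close>. An elongated box therefore loses enough area by its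
shape alone, and otherwise \<open>A\<close> misses a square of area \<open>4 * l\<^sup>2\<close> or the strict case of the dichotomy
applies.\<close>

lemma area_bound:
  assumes A: "compact A" "connected A" and tb: "tight_box A x0 x1 y0 y1"
    and far: "far_from_squares A l" "0 \<le> l"
  shows "measure lebesgue A \<le> (((x1 - x0) + (y1 - y0)) / 2)\<^sup>2 - 4 * l\<^sup>2" (is "?V \<le> ?M")
    and "measure lebesgue A = (((x1 - x0) + (y1 - y0)) / 2)\<^sup>2 - 4 * l\<^sup>2 \<Longrightarrow>
      (\<bar>(y1 - y0) - (x1 - x0)\<bar> = 4 * l \<and> measure lebesgue A = (x1 - x0) * (y1 - y0)) \<or>
      (0 < l \<and> x1 - x0 = y1 - y0 \<and> measure lebesgue A = (x1 - x0) * (y1 - y0) - 4 * l\<^sup>2 \<and>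
       (\<exists>x y. x0 + l \<le> x \<and> x \<le> x1 - l \<and> y0 + l \<le> y \<and> y \<le> y1 - l \<and> misses A l x y))"
      (is "_ \<Longrightarrow> ?E")
proof -
  define a where "a = x1 - x0"
  define b where "b = y1 - y0"
  have x01: "x0 \<le> x1" "y0 \<le> y1" using tb by (auto simp: tight_box_def)
  have amgm: "a * b = ((a + b) / 2)\<^sup>2 - ((b - a) / 2)\<^sup>2"
    by (simp add: power2_eq_square field_simps)
  have "?V \<le> ?M \<and> (?V = ?M \<longrightarrow> ?E)"
  proof (cases "4 * l \<le> \<bar>b - a\<bar>")
    case True
    have "?V \<le> measure lebesgue ({x0..x1} \<times> {y0..y1})"
      using tb x01 A(1) by (intro measure_mono_fmeasurable measure_rect(2)) (auto simp: tight_box_def lmeasurable_compact fmeasurableD)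
    then have V: "?V \<le> a * b" using x01 by (simp add: measure_rect a_def b_def)
    have sq: "4 * l\<^sup>2 \<le> ((b - a) / 2)\<^sup>2"
      using power_mono[OF True, of 2] far(2) by (simp add: power_divide power_mult_distrib)
    have "\<bar>b - a\<bar> = 4 * l" if "?V = ?M"
    proof -
      have "((b - a) / 2)\<^sup>2 = 4 * l\<^sup>2"
        using that V sq amgm by (simp add: a_def[symmetric] b_def[symmetric])
      then have "\<bar>b - a\<bar>\<^sup>2 = (4 * l)\<^sup>2" by (simp add: power_divide power_mult_distrib)
      then have "\<bar>b - a\<bar> = 4 * l" by (rule power2_eq_imp_eq) (use far(2) in auto)
      then show ?thesis .
    qed
    then show ?thesis using V sq amgm unfolding a_def b_def by auto
  next
    case False
    then have l: "0 < l" using far(2) by auto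
    from missed_square_dichotomy[OF A tb far(1) l] False
    consider (in_box) x y where "x0 + l \<le> x" "x \<le> x1 - l" "y0 + l \<le> y" "y \<le> y1 - l" "misses A l x y"
      | (small) "?V < ?M" by (auto simp: a_def b_def)
    then show ?thesis
    proof cases
      case in_box
      have V: "?V \<le> a * b - 4 * l\<^sup>2"
        using missed_square_in_box_area[OF A(1) tb far(2) in_box] by (simp add: a_def b_def)
      have M: "?M = ((a + b) / 2)\<^sup>2 - 4 * l\<^sup>2" by (simp add: a_def b_def)
      have "0 \<le> ((b - a) / 2)\<^sup>2" by simp
      then have 1: "?V \<le> ?M" using V amgm unfolding M by linarith
      have "((b - a) / 2)\<^sup>2 \<le> 0 \<and> ?V = a * b - 4 * l\<^sup>2" if "?V = ?M"
        using that V amgm \<open>0 \<le> ((b - a) / 2)\<^sup>2\<close> unfolding M by linarith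
      then have "?V = ?M \<longrightarrow> x1 - x0 = y1 - y0 \<and> ?V = (x1 - x0) * (y1 - y0) - 4 * l\<^sup>2"
        by (auto simp: a_def b_def)
      then show ?thesis using 1 in_box l by blast
    qed auto
  qed
  then show "?V \<le> ?M" "?V = ?M \<Longrightarrow> ?E" by blast+
qed

section \<open>Topology and area of domains\<close>

text \<open>From here on a domain enters only through these topological properties and its boundary loop.\<close>

lemma is_domain_props:
  assumes "is_domain A"
  shows "compact A" "connected A" "A = closure (interior A)" "interior A \<noteq> {}"
proof -
  obtain \<gamma> C where \<gamma>: "jordan_curve \<gamma>" and C: "C \<in> components (- path_image \<gamma>)" "bounded C" "A = closure C"
    using assms unfolding is_domain_def by blast
  have "closed (path_image \<gamma>)"
    using \<gamma> by (simp add: jordan_curve_def simple_path_def closed_path_image)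
  then have "open C" using C(1) open_components[of "- path_image \<gamma>"] by (simp add: open_Compl)
  show "compact A" using C by (simp add: compact_closure)
  show "connected A" using C in_components_connected by (metis connected_imp_connected_closure)
  have sub: "C \<subseteq> interior A" using \<open>open C\<close> C(3) by (simp add: closure_subset interior_maximal)
  then show "interior A \<noteq> {}" using in_components_nonempty[OF C(1)] by auto
  have "closure (interior A) \<subseteq> A" using \<open>compact A\<close> by (simp add: closure_minimal compact_imp_closed interior_subset)
  then show "A = closure (interior A)" using closure_mono[OF sub] C(3) by auto
qed

lemma compact_has_tight_box:
  assumes "compact A" "A \<noteq> {}"
  obtains x0 x1 y0 y1 where "tight_box A x0 x1 y0 y1"
proof -
  have cf: "continuous_on A fst" and cs: "continuous_on A snd"
    for A :: "(real \<times> real) set" by (auto intro: continuous_intros)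
  obtain p where p: "p \<in> A" "\<And>q. q \<in> A \<Longrightarrow> fst p \<le> fst q"
    using continuous_attains_inf[OF assms cf] by auto
  obtain p' where p': "p' \<in> A" "\<And>q. q \<in> A \<Longrightarrow> fst q \<le> fst p'"
    using continuous_attains_sup[OF assms cf] by auto
  obtain r where r: "r \<in> A" "\<And>q. q \<in> A \<Longrightarrow> snd r \<le> snd q"
    using continuous_attains_inf[OF assms cs] by auto
  obtain r' where r': "r' \<in> A" "\<And>q. q \<in> A \<Longrightarrow> snd q \<le> snd r'"
    using continuous_attains_sup[OF assms cs] by auto
  have "tight_box A (fst p) (fst p') (snd r) (snd r')"
    unfolding tight_box_def using p p' r r' by (auto simp: mem_Times_iff)
  then show ?thesis by (rule that)
qed

lemma tight_box_interior:
  assumes "tight_box A x0 x1 y0 y1"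
  shows "interior A \<subseteq> {x0<..<x1} \<times> {y0<..<y1}"
proof -
  have "interior A \<subseteq> interior ({x0..x1} \<times> {y0..y1})"
    using assms by (intro interior_mono) (simp add: tight_box_def)
  then show ?thesis by (simp add: interior_Times)
qed

lemma tight_box_frontier:
  assumes "compact A" "tight_box A x0 x1 y0 y1" and p: "p \<in> A" "fst p = x0 \<or> fst p = x1 \<or> snd p = y0 \<or> snd p = y1"
  shows "p \<in> frontier A"
proof -
  have "p \<notin> interior A" using tight_box_interior[OF assms(2)] p by (auto simp: mem_Times_iff)
  then show ?thesis using p closure_subset by (auto simp: frontier_def)
qed

text \<open>\<open>G - A\<close> is open, and it is null because \<open>A\<close> has full measure in \<open>B - U\<close>; a null open set is empty.\<close>

lemma open_subset_of_full_measure: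
  fixes A :: "(real \<times> real) set"
  assumes A: "compact A" "A \<subseteq> B" and B: "B \<in> lmeasurable"
    and U: "U \<in> lmeasurable" "U \<subseteq> B" "U \<inter> A = {}"
    and full: "measure lebesgue A = measure lebesgue B - measure lebesgue U"
    and G: "open G" "G \<subseteq> B" "G \<inter> U = {}"
  shows "G \<subseteq> A"
proof (rule ccontr)
  assume "\<not> G \<subseteq> A"
  then have ne: "G - A \<noteq> {}" by blast
  have op: "open (G - A)" using G(1) A(1) by (simp add: open_Diff compact_imp_closed)
  have lm: "G - A \<in> lmeasurable"
    by (rule fmeasurableI2[OF B]) (use G(2) op in \<open>auto simp: borel_open\<close>)
  have "measure lebesgue A \<le> measure lebesgue B - measure lebesgue (U \<union> (G - A))"
    by (rule measure_le_rect_minus) (use A U B G lm in \<open>auto simp: lmeasurable_compact\<close>)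
  moreover have "measure lebesgue (U \<union> (G - A)) = measure lebesgue U + measure lebesgue (G - A)"
  proof -
    have "U \<inter> (G - A) = {}" using G(3) by blast
    then show ?thesis using measure_Un3[OF U(1) lm] by simp
  qed
  ultimately have "measure lebesgue (G - A) = 0" using full measure_nonneg[of lebesgue "G - A"] by simp
  then have "negligible (G - A)" using lm by (simp add: negligible_iff_measure)
  then show False using open_not_negligible[OF op ne] by blast
qed

lemma full_box:
  assumes A: "compact A" "tight_box A x0 x1 y0 y1" "x0 < x1" "y0 < y1"
    and full: "measure lebesgue A = (x1 - x0) * (y1 - y0)"
  shows "A = {x0..x1} \<times> {y0..y1}"
proof
  show sub: "A \<subseteq> {x0..x1} \<times> {y0..y1}" using A by (simp add: tight_box_def)
  have "{x0<..<x1} \<times> {y0<..<y1} \<subseteq> A"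
    by (rule open_subset_of_full_measure[where B = "{x0..x1} \<times> {y0..y1}" and U = "{}"])
      (use A full sub in \<open>auto simp: measure_rect open_Times\<close>)
  then have "closure ({x0<..<x1} \<times> {y0<..<y1}) \<subseteq> A"
    using A(1) by (simp add: closure_minimal compact_imp_closed)
  then show "{x0..x1} \<times> {y0..y1} \<subseteq> A" using A by (simp add: closure_Times)
qed

text \<open>Only the interior is determined directly: the box without the open square would contain spurious segments
of the boundary of the box wherever the square touches it.\<close>

lemma interior_box_minus_square:
  assumes A: "compact A" "tight_box A x0 x1 y0 y1" "A = closure (interior A)" and l: "0 < l"
    and Q: "x0 + l \<le> x" "x \<le> x1 - l" "y0 + l \<le> y" "y \<le> y1 - l" "misses A l x y"
    and full: "measure lebesgue A = (x1 - x0) * (y1 - y0) - 4 * l\<^sup>2"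
  shows "interior A = {x0<..<x1} \<times> {y0<..<y1} - {x - l..x + l} \<times> {y - l..y + l}"
proof
  let ?Q = "{x - l<..<x + l} \<times> {y - l<..<y + l}"
  have QA: "?Q \<inter> A = {}" using Q(5) by (force simp: misses_def abs_if split: if_splits)
  have "?Q \<inter> interior A = {}" using QA interior_subset by blast
  then have "closure ?Q \<inter> interior A = {}" by (metis Int_commute open_Int_closure_eq_empty open_interior)
  then have "({x - l..x + l} \<times> {y - l..y + l}) \<inter> interior A = {}" using l by (simp add: closure_Times)
  then show "interior A \<subseteq> {x0<..<x1} \<times> {y0<..<y1} - {x - l..x + l} \<times> {y - l..y + l}"
    using tight_box_interior[OF A(2)] by blast
  have op: "open ({x0<..<x1} \<times> {y0<..<y1} - {x - l..x + l} \<times> {y - l..y + l})"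
    by (intro open_Diff open_Times closed_Times) auto
  have "{x0<..<x1} \<times> {y0<..<y1} - {x - l..x + l} \<times> {y - l..y + l} \<subseteq> A"
  proof (rule open_subset_of_full_measure[where B = "{x0..x1} \<times> {y0..y1}" and U = ?Q])
    show "A \<subseteq> {x0..x1} \<times> {y0..y1}" using A(2) by (simp add: tight_box_def)
    show "{x0..x1} \<times> {y0..y1} \<in> lmeasurable" by (rule measure_rect(2)) (use Q l in auto)
    show "?Q \<in> lmeasurable" by (rule measure_open_rect(2)) (use l in auto)
    show "?Q \<subseteq> {x0..x1} \<times> {y0..y1}" using Q by auto
    show "measure lebesgue A = measure lebesgue ({x0..x1} \<times> {y0..y1}) - measure lebesgue ?Q"
      using full Q l by (simp add: measure_rect measure_open_rect power2_eq_square)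
  qed (use QA A(1) op in auto)
  then show "{x0<..<x1} \<times> {y0<..<y1} - {x - l..x + l} \<times> {y - l..y + l} \<subseteq> interior A"
    using op by (simp add: interior_maximal)
qed

section \<open>Perimeter of a domain with a missing square\<close>

lemma tight_box_perimeter:
  assumes A: "compact A" "tight_box A x0 x1 y0 y1"
    and \<gamma>: "jordan_curve \<gamma>" "path_image \<gamma> = frontier A" "l1_rectifiable \<gamma>"
  shows "2 * (x1 - x0) + 2 * (y1 - y0) \<le> l1_length \<gamma>"
proof -
  have time: "\<exists>t\<in>{0..1}. \<gamma> t = p"
    if "p \<in> A" "fst p = x0 \<or> fst p = x1 \<or> snd p = y0 \<or> snd p = y1" for p
    using tight_box_frontier[OF A that] \<gamma>(2) unfolding path_image_def by (metis imageE)
  obtain p1 p2 p3 p4 where p: "p1 \<in> A" "fst p1 = x0" "p2 \<in> A" "fst p2 = x1" "p3 \<in> A" "snd p3 = y0" "p4 \<in> A" "snd p4 = y1"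
    using A(2) by (auto simp: tight_box_def)
  obtain t1 where "t1 \<in> {0..1}" "\<gamma> t1 = p1" using time[of p1] p by blast
  moreover obtain t2 where "t2 \<in> {0..1}" "\<gamma> t2 = p2" using time[of p2] p by blast
  moreover obtain t3 where "t3 \<in> {0..1}" "\<gamma> t3 = p3" using time[of p3] p by blast
  moreover obtain t4 where "t4 \<in> {0..1}" "\<gamma> t4 = p4" using time[of p4] p by blast
  moreover have "\<gamma> 0 = \<gamma> 1" using \<gamma>(1) by (simp add: jordan_curve_def pathstart_def pathfinish_def)
  ultimately show ?thesis using p \<gamma>(3) by (intro loop_length_ge[of \<gamma> t1 t2 _ _ t3 t4]) auto
qed

text \<open>If the removed square has \<open>A\<close> on both of its sides in the direction \<open>f1\<close>, then at the heights of the
square the frontier of \<open>A\<close> consists of the two sides of the box and the two sides of the square.\<close>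

lemma interior_hole_perimeter:
  fixes f1 f2 :: "real \<times> real \<Rightarrow> real"
  assumes coord: "(f1 = fst \<and> f2 = snd) \<or> (f1 = snd \<and> f2 = fst)"
    and A: "closed A" "A = closure (interior A)"
    and \<gamma>: "jordan_curve \<gamma>" "path_image \<gamma> = frontier A" "l1_rectifiable \<gamma>"
    and int: "interior A = {p. f1 p \<in> {x0<..<x1} \<and> f2 p \<in> {y0<..<y1} \<and> \<not> (f1 p \<in> {x - l..x + l} \<and> f2 p \<in> {y - l..y + l})}"
    and miss: "\<And>p. p \<in> A \<Longrightarrow> l \<le> \<bar>f1 p - x\<bar> \<or> l \<le> \<bar>f2 p - y\<bar>"
    and l: "0 < l" and Q: "x0 + l < x" "x < x1 - l" "y0 + l \<le> y" "y \<le> y1 - l"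
    and tight: "\<And>p. p \<in> A \<Longrightarrow> f1 p \<in> {x0..x1} \<and> f2 p \<in> {y0..y1}"
      "\<exists>p\<in>A. f1 p = x0" "\<exists>p\<in>A. f1 p = x1" "\<exists>p\<in>A. f2 p = y0" "\<exists>p\<in>A. f2 p = y1"
  shows "2 * (x1 - x0) + 2 * (y1 - y0) < l1_length \<gamma>"
proof -
  have fr: "frontier A = A - interior A" using A(1) by (simp add: frontier_def)
  have time: "\<exists>t\<in>{0..1}. \<gamma> t = p" if "p \<in> A - interior A" for p
    using that \<gamma>(2) fr unfolding path_image_def by (metis imageE)
  obtain p1 p2 p3 p4 where p: "p1 \<in> A" "f1 p1 = x0" "p2 \<in> A" "f1 p2 = x1" "p3 \<in> A" "f2 p3 = y0" "p4 \<in> A" "f2 p4 = y1"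
    using tight by blast
  obtain t1 where t1: "t1 \<in> {0..1}" "\<gamma> t1 = p1" using time[of p1] p int by auto
  obtain t2 where t2: "t2 \<in> {0..1}" "\<gamma> t2 = p2" using time[of p2] p int by auto
  obtain t3 where t3: "t3 \<in> {0..1}" "\<gamma> t3 = p3" using time[of p3] p int by auto
  obtain t4 where t4: "t4 \<in> {0..1}" "\<gamma> t4 = p4" using time[of p4] p int by auto
  have loop: "\<gamma> 0 = \<gamma> 1" using \<gamma>(1) by (simp add: jordan_curve_def pathstart_def pathfinish_def)
  let ?X = "{x0, x - l, x + l, x1}"
  have column: "\<exists>p\<in>A. f1 p = u \<and> f2 p = y"
    if ab: "a < b" "u \<in> {a..b}" "x0 \<le> a" "b \<le> x1" "b \<le> x - l \<or> x + l \<le> a" for a b u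
    using coord
  proof
    assume c: "f1 = fst \<and> f2 = snd"
    have "{a<..<b} \<times> {y0<..<y1} \<subseteq> interior A" unfolding int using ab c by auto
    then have "closure ({a<..<b} \<times> {y0<..<y1}) \<subseteq> A" using A(2) closure_mono by metis
    then have "{a..b} \<times> {y0..y1} \<subseteq> A" using ab Q l by (simp add: closure_Times)
    moreover have "(u, y) \<in> {a..b} \<times> {y0..y1}" using ab Q l by auto
    ultimately show ?thesis using c by (intro bexI[of _ "(u, y)"]) auto
  next
    assume c: "f1 = snd \<and> f2 = fst"
    have "{y0<..<y1} \<times> {a<..<b} \<subseteq> interior A" unfolding int using ab c by auto
    then have "closure ({y0<..<y1} \<times> {a<..<b}) \<subseteq> A" using A(2) closure_mono by metis
    then have "{y0..y1} \<times> {a..b} \<subseteq> A" using ab Q l by (simp add: closure_Times)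
    moreover have "(y, u) \<in> {y0..y1} \<times> {a..b}" using ab Q l by auto
    ultimately show ?thesis using c by (intro bexI[of _ "(y, u)"]) auto
  qed
  show ?thesis
  proof (rule loop_length_ge_four_lines[OF \<gamma>(3) loop coord, of t1 t2 x0 x1 t3 t4 y0 y1 "y - l" "y + l" ?X])
    show "card ?X = 4" using Q l by simp
    fix u assume u: "u \<in> ?X"
    have "\<exists>p\<in>A. f1 p = u \<and> f2 p = y"
    proof (cases "u \<le> x - l")
      case True
      then show ?thesis using u Q l by (intro column[of x0 "x - l"]) auto
    next
      case False
      then show ?thesis using u Q l by (intro column[of "x + l" x1]) auto
    qed
    moreover have "p \<notin> interior A" if "f1 p = u" "f2 p = y" for p
      using that u l unfolding int by auto
    ultimately show "\<exists>p\<in>path_image \<gamma>. f1 p = u \<and> f2 p = (y - l + (y + l)) / 2"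
      unfolding \<gamma>(2) fr by auto
  next
    fix p assume "p \<in> path_image \<gamma>" and band: "y - l < f2 p" "f2 p < y + l"
    then have pA: "p \<in> A" "p \<notin> interior A" using \<gamma>(2) fr by auto
    have "l \<le> \<bar>f1 p - x\<bar>" using miss[OF pA(1)] band by auto
    moreover have "f1 p = x0 \<or> f1 p = x1 \<or> f1 p \<in> {x - l..x + l}"
      using pA(2) tight(1)[OF pA(1)] band Q unfolding int by auto
    ultimately show "f1 p \<in> ?X" by auto
  qed (use t1 t2 t3 t4 p Q l in auto)
qed

lemma missed_square_at_corner:
  assumes A: "compact A" "A = closure (interior A)" and tb: "tight_box A x0 x1 y0 y1"
    and \<gamma>: "jordan_curve \<gamma>" "path_image \<gamma> = frontier A" "l1_rectifiable \<gamma>"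
    and len: "l1_length \<gamma> \<le> 2 * (x1 - x0) + 2 * (y1 - y0)"
    and l: "0 < l" and Q: "x0 + l \<le> x" "x \<le> x1 - l" "y0 + l \<le> y" "y \<le> y1 - l" "misses A l x y"
    and int: "interior A = {x0<..<x1} \<times> {y0<..<y1} - {x - l..x + l} \<times> {y - l..y + l}"
  shows "(x = x0 + l \<or> x = x1 - l) \<and> (y = y0 + l \<or> y = y1 - l)"
proof (rule ccontr)
  assume "\<not> ?thesis"
  then consider (x) "x0 + l < x" "x < x1 - l" | (y) "y0 + l < y" "y < y1 - l"
    using Q by force
  then show False
  proof cases
    case x
    have "2 * (x1 - x0) + 2 * (y1 - y0) < l1_length \<gamma>"
    proof (rule interior_hole_perimeter[of fst snd A \<gamma> x0 x1 y0 y1 x l y, OF _ _ A(2) \<gamma>])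
      show "closed A" using A(1) by (rule compact_imp_closed)
      show "interior A = {p. fst p \<in> {x0<..<x1} \<and> snd p \<in> {y0<..<y1} \<and> \<not> (fst p \<in> {x - l..x + l} \<and> snd p \<in> {y - l..y + l})}"
        unfolding int by auto
    qed (use x Q l tb in \<open>auto simp: misses_def tight_box_def\<close>)
    then show False using len by simp
  next
    case y
    have "2 * (y1 - y0) + 2 * (x1 - x0) < l1_length \<gamma>"
    proof (rule interior_hole_perimeter[of snd fst A \<gamma> y0 y1 x0 x1 y l x, OF _ _ A(2) \<gamma>])
      show "closed A" using A(1) by (rule compact_imp_closed)
      show "interior A = {p. snd p \<in> {y0<..<y1} \<and> fst p \<in> {x0<..<x1} \<and> \<not> (snd p \<in> {y - l..y + l} \<and> fst p \<in> {x - l..x + l})}"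
        unfolding int by auto
    qed (use y Q l tb in \<open>auto simp: misses_def tight_box_def\<close>)
    then show False using len by simp
  qed
qed

section \<open>Shapes similar to a rectangle or a notched square\<close>

definition axis_map :: "real \<Rightarrow> real \<Rightarrow> real \<Rightarrow> real \<Rightarrow> real \<times> real \<Rightarrow> real \<times> real" where
  "axis_map c1 c2 k1 k2 p = (c1 + k1 * fst p, c2 + k2 * snd p)"

lemma l1_isometry_signed:
  assumes "\<bar>\<sigma>\<bar> = 1" "\<bar>\<tau>\<bar> = 1"
  shows "l1_isometry (axis_map c1 c2 \<sigma> \<tau>)" "l1_isometry (axis_map c1 c2 \<sigma> \<tau> \<circ> prod.swap)"
proof -
  have nz: "\<sigma> \<noteq> 0" "\<tau> \<noteq> 0" using assms by auto
  have "surj (axis_map c1 c2 \<sigma> \<tau>)"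
    unfolding surj_def
  proof
    fix p
    show "\<exists>q. p = axis_map c1 c2 \<sigma> \<tau> q"
      by (rule exI[of _ "((fst p - c1) / \<sigma>, (snd p - c2) / \<tau>)"]) (use nz in \<open>simp add: axis_map_def\<close>)
  qed
  moreover have "surj (prod.swap :: real \<times> real \<Rightarrow> real \<times> real)" by simp
  moreover have "l1_dist (axis_map c1 c2 \<sigma> \<tau> p) (axis_map c1 c2 \<sigma> \<tau> q) = l1_dist p q" for p q
    using assms by (simp add: l1_dist_def axis_map_def abs_mult flip: right_diff_distrib)
  ultimately show "l1_isometry (axis_map c1 c2 \<sigma> \<tau>)" "l1_isometry (axis_map c1 c2 \<sigma> \<tau> \<circ> prod.swap)"
    unfolding l1_isometry_def
    by (blast, intro conjI comp_surj allI) (assumption | simp add: l1_dist_def)+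
qed

text \<open>The homothety is \<open>p \<mapsto> s p\<close>, and signs, swap and translation go into the isometry.\<close>

lemma similar_toI:
  assumes "s \<noteq> 0" "\<bar>\<sigma>\<bar> = 1" "\<bar>\<tau>\<bar> = 1"
    and "A = axis_map c1 c2 (\<sigma> * s) (\<tau> * s) ` M \<or> A = axis_map c1 c2 (\<sigma> * s) (\<tau> * s) ` prod.swap ` M"
  shows "similar_to A M"
proof -
  have h: "homothety (\<lambda>x. 0 + s *\<^sub>R (x - 0))" unfolding homothety_def using assms(1) by blast
  have 1: "axis_map c1 c2 (\<sigma> * s) (\<tau> * s) ` M = axis_map c1 c2 \<sigma> \<tau> ` (\<lambda>x. 0 + s *\<^sub>R (x - 0)) ` M"
    by (simp add: image_image axis_map_def mult.assoc)
  have 2: "axis_map c1 c2 (\<sigma> * s) (\<tau> * s) ` prod.swap ` M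
      = (axis_map c1 c2 \<sigma> \<tau> \<circ> prod.swap) ` (\<lambda>x. 0 + s *\<^sub>R (x - 0)) ` M"
    by (simp add: image_image axis_map_def mult.assoc)
  from assms(4) show ?thesis
    unfolding similar_to_def using h l1_isometry_signed[OF assms(2,3)] 1 2 by metis
qed

lemma axis_map_image_Times:
  "axis_map c1 c2 k1 k2 ` (X \<times> Y) = ((\<lambda>u. k1 * u + c1) ` X) \<times> ((\<lambda>v. k2 * v + c2) ` Y)"
  by (force simp: axis_map_def image_iff add.commute)

lemma affine_image_interval:
  fixes m c u :: real
  assumes "0 \<le> u"
  shows "0 \<le> m \<Longrightarrow> (\<lambda>x. m * x + c) ` {0..u} = {c..c + m * u}"
    and "m < 0 \<Longrightarrow> (\<lambda>x. m * x + c) ` {0..u} = {c + m * u..c}"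
  using assms unfolding image_affinity_atLeastAtMost by simp_all

lemma rect_similar_rect_R:
  assumes "x0 < x1" "y0 < y1"
  shows "\<exists>\<alpha>. 0 \<le> \<alpha> \<and> \<alpha> < 1 / 2 \<and> similar_to ({x0..x1} \<times> {y0..y1}) (rect_R \<alpha>)"
proof -
  define a b s \<alpha> where "a = x1 - x0" and "b = y1 - y0" and "s = (a + b) / 2" and "\<alpha> = \<bar>b - a\<bar> / (4 * s)"
  have pos: "0 < a" "0 < b" "0 < s" using assms by (auto simp: a_def b_def s_def)
  have al: "0 \<le> \<alpha>" "\<alpha> < 1 / 2" using pos by (auto simp: \<alpha>_def s_def field_simps abs_if)
  have sm: "s * (1 - 2 * \<alpha>) = min a b" "s * (1 + 2 * \<alpha>) = max a b"
    using pos by (auto simp: \<alpha>_def s_def field_simps abs_if)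
  have im: "axis_map x0 y0 (1 * s) (1 * s) ` ({0..u} \<times> {0..v}) = {x0..x0 + s * u} \<times> {y0..y0 + s * v}"
    if "0 \<le> u" "0 \<le> v" for u v
    using that pos by (simp add: axis_map_image_Times affine_image_interval)
  have "similar_to ({x0..x1} \<times> {y0..y1}) (rect_R \<alpha>)"
  proof (cases "a \<le> b")
    case True
    then have "{x0..x1} \<times> {y0..y1} = axis_map x0 y0 (1 * s) (1 * s) ` rect_R \<alpha>"
      unfolding rect_R_def using al sm by (subst im) (auto simp: a_def b_def)
    then show ?thesis using pos by (intro similar_toI[of s 1 1]) auto
  next
    case False
    then have "{x0..x1} \<times> {y0..y1} = axis_map x0 y0 (1 * s) (1 * s) ` prod.swap ` rect_R \<alpha>"
      unfolding rect_R_def swap_image_Times using al sm by (subst im) (auto simp: a_def b_def)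
    then show ?thesis using pos by (intro similar_toI[of s 1 1]) auto
  qed
  then show ?thesis using al by blast
qed

lemma notched_square_union:
  assumes "0 \<le> \<delta>" "\<delta> < 1 / 2"
  shows "notched_square \<delta> = {0..1} \<times> {0..1 - 2 * \<delta>} \<union> {0..1 - 2 * \<delta>} \<times> {0..1}"
  using assms unfolding notched_square_def by auto

text \<open>One coordinate of the corner position: the affine map that turns \<open>{0..1}\<close> into the side of the box is
reversed when the square touches the lower end, so that the notch always comes from the upper end of \<open>{0..1}\<close>.\<close>

lemma corner_interval:
  fixes x0 x1 x l :: real
  assumes "x = x0 + l \<or> x = x1 - l" "0 < l" "2 * l < x1 - x0"
  obtains c \<sigma> a b where "\<bar>\<sigma>\<bar> = 1" "a < b" "{x0<..<x1} - {x - l..x + l} = {a<..<b}"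
    "(\<lambda>u. \<sigma> * (x1 - x0) * u + c) ` {0..1} = {x0..x1}"
    "(\<lambda>u. \<sigma> * (x1 - x0) * u + c) ` {0..1 - 2 * (l / (x1 - x0))} = {a..b}"
proof -
  define s where "s = x1 - x0"
  have s: "0 < s" "0 \<le> 1 - 2 * (l / s)" "s * (1 - 2 * (l / s)) = s - 2 * l"
    using assms by (auto simp: s_def field_simps)
  show ?thesis
  proof (cases "x = x0 + l")
    case True
    have end_pt: "x1 + - s * (1 - 2 * (l / s)) = x0 + 2 * l"
      unfolding mult_minus_left s(3) unfolding s_def by argo
    have "(\<lambda>u. - s * u + x1) ` {0..1} = {x1 + - s * 1..x1}"
      "(\<lambda>u. - s * u + x1) ` {0..1 - 2 * (l / s)} = {x1 + - s * (1 - 2 * (l / s))..x1}"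
      by (rule affine_image_interval(2), use s in simp, use s in simp)+
    then have "(\<lambda>u. -1 * s * u + x1) ` {0..1} = {x0..x1}"
      "(\<lambda>u. -1 * s * u + x1) ` {0..1 - 2 * (l / s)} = {x0 + 2 * l..x1}"
      unfolding end_pt by (simp_all add: s_def)
    then show ?thesis using True assms unfolding s_def
      by (intro that[of "-1" "x0 + 2 * l" x1 x1]) auto
  next
    case False
    have end_pt: "x0 + s * (1 - 2 * (l / s)) = x1 - 2 * l"
      unfolding s(3) unfolding s_def by argo
    have "(\<lambda>u. s * u + x0) ` {0..1} = {x0..x0 + s * 1}"
      "(\<lambda>u. s * u + x0) ` {0..1 - 2 * (l / s)} = {x0..x0 + s * (1 - 2 * (l / s))}"
      by (rule affine_image_interval(1), use s in simp, use s in simp)+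
    then have "(\<lambda>u. 1 * s * u + x0) ` {0..1} = {x0..x1}"
      "(\<lambda>u. 1 * s * u + x0) ` {0..1 - 2 * (l / s)} = {x0..x1 - 2 * l}"
      unfolding end_pt by (simp_all add: s_def)
    then show ?thesis using False assms unfolding s_def
      by (intro that[of 1 x0 "x1 - 2 * l" x0]) auto
  qed
qed

lemma corner_notch_similar_notched_square:
  assumes A: "A = closure (interior A)"
    and l: "0 < l" "2 * l < x1 - x0" and sq: "x1 - x0 = y1 - y0"
    and corner: "x = x0 + l \<or> x = x1 - l" "y = y0 + l \<or> y = y1 - l"
    and int: "interior A = {x0<..<x1} \<times> {y0<..<y1} - {x - l..x + l} \<times> {y - l..y + l}"
  shows "\<exists>\<delta>. 0 \<le> \<delta> \<and> \<delta> < 1 / 2 \<and> similar_to A (notched_square \<delta>)"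
proof -
  define s where "s = x1 - x0"
  define \<delta> where "\<delta> = l / s"
  have s: "0 < s" "s = y1 - y0" using l sq by (auto simp: s_def)
  have \<delta>: "0 \<le> \<delta>" "\<delta> < 1 / 2" using l s by (auto simp: \<delta>_def s_def field_simps)
  obtain c1 \<sigma> a b where x: "\<bar>\<sigma>\<bar> = 1" "a < b" "{x0<..<x1} - {x - l..x + l} = {a<..<b}"
    "(\<lambda>u. \<sigma> * s * u + c1) ` {0..1} = {x0..x1}" "(\<lambda>u. \<sigma> * s * u + c1) ` {0..1 - 2 * \<delta>} = {a..b}"
    using corner_interval[OF corner(1) l] unfolding \<delta>_def s_def by metis
  obtain c2 \<tau> c d where y: "\<bar>\<tau>\<bar> = 1" "c < d" "{y0<..<y1} - {y - l..y + l} = {c<..<d}"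
    "(\<lambda>u. \<tau> * s * u + c2) ` {0..1} = {y0..y1}" "(\<lambda>u. \<tau> * s * u + c2) ` {0..1 - 2 * \<delta>} = {c..d}"
    using corner_interval[OF corner(2) l(1)] l(2) unfolding \<delta>_def s_def sq by metis
  have "interior A = {x0<..<x1} \<times> {c<..<d} \<union> {a<..<b} \<times> {y0<..<y1}"
    unfolding int x(3)[symmetric] y(3)[symmetric] by blast
  then have "A = closure ({x0<..<x1} \<times> {c<..<d} \<union> {a<..<b} \<times> {y0<..<y1})" using A by simp
  also have "\<dots> = {x0..x1} \<times> {c..d} \<union> {a..b} \<times> {y0..y1}"
    using x(2) y(2) l sq by (simp add: closure_Times)
  also have "\<dots> = axis_map c1 c2 (\<sigma> * s) (\<tau> * s) ` notched_square \<delta>"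
    unfolding notched_square_union[OF \<delta>] image_Un axis_map_image_Times x y ..
  finally have "similar_to A (notched_square \<delta>)"
    using s x(1) y(1) by (intro similar_toI[of s \<sigma> \<tau>]) auto
  then show ?thesis using \<delta> by blast
qed

section \<open>Length of a simple curve on a grid\<close>

text \<open>On each arc the first coordinate takes all values between those at its end points. Apart from finitely
many values these are taken on the horizontal segments, so the arc occupies on them a set of at least
that measure. Arcs over different parameter intervals are disjoint up to end points, so together they
occupy at most the total length of the segments.\<close>

lemma simple_path_fst_variation_le:
  fixes \<gamma> :: "real \<Rightarrow> real \<times> real" and a b h :: "'i \<Rightarrow> real"
  assumes \<gamma>: "simple_path \<gamma>" and fin: "finite I" "finite V"
    and ab: "\<And>i. i \<in> I \<Longrightarrow> a i \<le> b i"
    and img: "path_image \<gamma> \<subseteq> (\<Union>i\<in>I. {a i..b i} \<times> {h i}) \<union> {p. fst p \<in> V}"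
    and t: "mono_on {..n} t" "t ` {..n} \<subseteq> {0..1}"
  shows "(\<Sum>k<n. \<bar>fst (\<gamma> (t k)) - fst (\<gamma> (t (Suc k)))\<bar>) \<le> (\<Sum>i\<in>I. b i - a i)"
proof -
  have cont: "continuous_on {0..1} \<gamma>" using \<gamma> by (simp add: simple_path_def path_def)
  have t01: "t k \<in> {0..1}" if "k \<le> n" for k using t(2) that by auto
  have tmono: "t j \<le> t k" if "j \<le> k" "k \<le> n" for j k
    using t(1) that by (auto simp: mono_on_def)
  define K where "K k = \<gamma> ` {t k..t (Suc k)}" for k
  \<comment> \<open>Dropping both end points makes the arcs disjoint, also across the closing point of a loop.\<close>
  define E where "E k = K k - {\<gamma> (t k), \<gamma> (t (Suc k))}" for k
  define S where "S k i = {x \<in> {a i..b i}. (x, h i) \<in> E k}" for k i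
  have sub01: "{t k..t (Suc k)} \<subseteq> {0..1}" if "k < n" for k
    using t01[of k] t01[of "Suc k"] that by auto
  have meas: "S k i \<in> lmeasurable" if k: "k < n" for k i
  proof -
    have cl: "closed ((\<lambda>x. (x, h i)) -` C)" if "closed C" for C :: "(real \<times> real) set"
      using that by (intro closed_vimage) (auto intro!: continuous_intros)
    have "compact (K k)"
      unfolding K_def by (intro compact_continuous_image continuous_on_subset[OF cont sub01[OF k]]) simp
    then have "compact ({a i..b i} \<inter> (\<lambda>x. (x, h i)) -` K k)"
      by (intro compact_Int_closed cl compact_imp_closed) auto
    moreover have "closed ((\<lambda>x. (x, h i)) -` {\<gamma> (t k), \<gamma> (t (Suc k))})"
      by (intro cl) (simp add: finite_imp_closed)
    ultimately have "{a i..b i} \<inter> (\<lambda>x. (x, h i)) -` K k - (\<lambda>x. (x, h i)) -` {\<gamma> (t k), \<gamma> (t (Suc k))} \<in> lmeasurable"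
      by (intro fmeasurable.Diff fmeasurable_Diff lmeasurable_compact) (auto intro: borel_closed)
    moreover have "S k i = {a i..b i} \<inter> (\<lambda>x. (x, h i)) -` K k - (\<lambda>x. (x, h i)) -` {\<gamma> (t k), \<gamma> (t (Suc k))}"
      unfolding S_def E_def by auto
    ultimately show ?thesis by simp
  qed
  have step: "\<bar>fst (\<gamma> (t k)) - fst (\<gamma> (t (Suc k)))\<bar> \<le> (\<Sum>i\<in>I. measure lebesgue (S k i))"
    if k: "k < n" for k
  proof -
    define u where "u = min (fst (\<gamma> (t k))) (fst (\<gamma> (t (Suc k))))"
    define v where "v = max (fst (\<gamma> (t k))) (fst (\<gamma> (t (Suc k))))"
    let ?F = "V \<union> {fst (\<gamma> (t k)), fst (\<gamma> (t (Suc k)))}"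
    have "connected (fst ` K k)"
      unfolding K_def by (intro connected_continuous_image continuous_intros continuous_on_subset[OF cont sub01[OF k]]) simp
    moreover have "\<gamma> (t k) \<in> K k" "\<gamma> (t (Suc k)) \<in> K k"
      using tmono[of k "Suc k"] k unfolding K_def by auto
    then have "u \<in> fst ` K k" "v \<in> fst ` K k" unfolding u_def v_def min_def max_def by auto
    ultimately have uv: "{u..v} \<subseteq> fst ` K k" by (rule connected_contains_Icc)
    have "{u..v} \<subseteq> (\<Union>i\<in>I. S k i) \<union> ?F"
    proof
      fix x assume "x \<in> {u..v}"
      then obtain w where w: "w \<in> {t k..t (Suc k)}" "x = fst (\<gamma> w)" using uv by (auto simp: K_def)
      then have "\<gamma> w \<in> path_image \<gamma>" "\<gamma> w \<in> K k" using sub01[OF k] by (auto simp: path_image_def K_def)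
      then consider (end_pt) "\<gamma> w \<in> {\<gamma> (t k), \<gamma> (t (Suc k))}" | (vert) "x \<in> V"
        | (hor) i where "i \<in> I" "x \<in> {a i..b i}" "\<gamma> w = (x, h i)" "\<gamma> w \<in> E k"
        using img w(2) unfolding E_def by fastforce
      then show "x \<in> (\<Union>i\<in>I. S k i) \<union> ?F"
      proof cases
        case end_pt then show ?thesis using w(2) by auto
      next
        case vert then show ?thesis by simp
      next
        case hor
        then have "x \<in> S k i" unfolding S_def by simp
        then show ?thesis using hor(1) by blast
      qed
    qed
    moreover have F: "negligible ?F" using fin(2) by (intro negligible_finite) auto
    have UM: "(\<Union>i\<in>I. S k i) \<in> lmeasurable" using fin(1) meas[OF k] by blast
    ultimately have "measure lebesgue {u..v} \<le> measure lebesgue ((\<Union>i\<in>I. S k i) \<union> ?F)"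
      by (intro measure_mono_fmeasurable fmeasurable.Un negligible_imp_measurable[OF F]) (simp_all only: lmeasurable_cbox cbox_interval[symmetric] fmeasurableD)
    also have "\<dots> \<le> measure lebesgue (\<Union>i\<in>I. S k i) + measure lebesgue ?F"
      by (intro measure_Un_le fmeasurableD UM negligible_imp_measurable[OF F])
    also have "measure lebesgue ?F = 0" using F by (rule negligible_imp_measure0)
    also have "measure lebesgue (\<Union>i\<in>I. S k i) + 0 \<le> (\<Sum>i\<in>I. measure lebesgue (S k i))"
      using measure_UNION_le[of I "S k" lebesgue] fin(1) meas[OF k] by auto
    finally have "measure lebesgue {u..v} \<le> (\<Sum>i\<in>I. measure lebesgue (S k i))" .
    moreover have "measure lebesgue {u..v} = v - u" "v - u = \<bar>fst (\<gamma> (t k)) - fst (\<gamma> (t (Suc k)))\<bar>"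
      unfolding u_def v_def by (auto simp: min_def max_def)
    ultimately show ?thesis by simp
  qed
  have disj: "E j \<inter> E k = {}" if jk: "j < k" "k < n" for j k
  proof (rule ccontr)
    assume "E j \<inter> E k \<noteq> {}"
    then obtain p where "p \<in> E j" "p \<in> E k" by blast
    then obtain u w where u: "u \<in> {t j..t (Suc j)}" "\<gamma> u \<notin> {\<gamma> (t j), \<gamma> (t (Suc j))}"
      and w: "w \<in> {t k..t (Suc k)}" "\<gamma> w \<notin> {\<gamma> (t k), \<gamma> (t (Suc k))}" and eq: "\<gamma> u = \<gamma> w"
      unfolding E_def K_def by (metis DiffE imageE)
    have uw: "u \<le> w" using u(1) w(1) tmono[of "Suc j" k] jk by auto
    have in01: "u \<in> {0..1}" "w \<in> {0..1}" using u(1) w(1) sub01[of j] sub01[of k] jk by auto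
    then have "u = w \<or> u = 0 \<and> w = 1"
      using \<gamma> eq uw unfolding simple_path_def loop_free_def by fastforce
    then show False
    proof
      assume "u = w"
      then have "u = t (Suc j)" using u(1) w(1) tmono[of "Suc j" k] jk by auto
      then show False using u(2) by simp
    next
      assume "u = 0 \<and> w = 1"
      then have "u = t j" using u(1) t01[of j] jk by auto
      then show False using u(2) by simp
    qed
  qed
  have tot: "(\<Sum>k<n. measure lebesgue (S k i)) \<le> b i - a i" if i: "i \<in> I" for i
  proof -
    have dS: "S j i \<inter> S k i = {}" if "j < k" "k < n" for j k
      using disj[OF that] unfolding S_def by blast
    have "pairwise (\<lambda>j k. disjnt (S j i) (S k i)) {..<n}"
      unfolding pairwise_def disjnt_def using dS by (metis Int_commute lessThan_iff linorder_neqE_nat)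
    then have "measure lebesgue (\<Union>k<n. S k i) = (\<Sum>k<n. measure lebesgue (S k i))"
      using meas by (intro measure_UNION') auto
    moreover have "measure lebesgue (\<Union>k<n. S k i) \<le> measure lebesgue {a i..b i}"
      using meas by (intro measure_mono_fmeasurable) (auto simp: S_def)
    ultimately show ?thesis using ab[OF i] by simp
  qed
  have "(\<Sum>k<n. \<bar>fst (\<gamma> (t k)) - fst (\<gamma> (t (Suc k)))\<bar>) \<le> (\<Sum>k<n. \<Sum>i\<in>I. measure lebesgue (S k i))"
    by (intro sum_mono step) auto
  also have "\<dots> = (\<Sum>i\<in>I. \<Sum>k<n. measure lebesgue (S k i))" by (rule sum.swap)
  also have "\<dots> \<le> (\<Sum>i\<in>I. b i - a i)" by (intro sum_mono tot)
  finally show ?thesis .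
qed

lemma simple_path_grid_length_le:
  fixes \<gamma> :: "real \<Rightarrow> real \<times> real" and a b h :: "'i \<Rightarrow> real" and c d v :: "'j \<Rightarrow> real"
  assumes \<gamma>: "simple_path \<gamma>" and fin: "finite I" "finite J"
    and ab: "\<And>i. i \<in> I \<Longrightarrow> a i \<le> b i" and cd: "\<And>j. j \<in> J \<Longrightarrow> c j \<le> d j"
    and img: "path_image \<gamma> \<subseteq> (\<Union>i\<in>I. {a i..b i} \<times> {h i}) \<union> (\<Union>j\<in>J. {v j} \<times> {c j..d j})"
    and t: "mono_on {..n} t" "t ` {..n} \<subseteq> {0..1}"
  shows "(\<Sum>k<n. l1_dist (\<gamma> (t k)) (\<gamma> (t (Suc k)))) \<le> (\<Sum>i\<in>I. b i - a i) + (\<Sum>j\<in>J. d j - c j)"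
proof -
  have x: "(\<Sum>k<n. \<bar>fst (\<gamma> (t k)) - fst (\<gamma> (t (Suc k)))\<bar>) \<le> (\<Sum>i\<in>I. b i - a i)"
  proof (rule simple_path_fst_variation_le[OF \<gamma> fin(1) _ ab _ t])
    show "finite (v ` J)" using fin by simp
    show "path_image \<gamma> \<subseteq> (\<Union>i\<in>I. {a i..b i} \<times> {h i}) \<union> {p. fst p \<in> v ` J}"
      using img by fastforce
  qed
  have "simple_path (prod.swap \<circ> \<gamma>)"
    using \<gamma> unfolding simple_path_def loop_free_def path_def
    by (auto simp: prod.swap_def prod_eq_iff intro!: continuous_intros)
  then have "(\<Sum>k<n. \<bar>fst ((prod.swap \<circ> \<gamma>) (t k)) - fst ((prod.swap \<circ> \<gamma>) (t (Suc k)))\<bar>) \<le> (\<Sum>j\<in>J. d j - c j)"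
  proof (rule simple_path_fst_variation_le[OF _ fin(2) _ cd _ t])
    show "finite (h ` I)" using fin by simp
    have "path_image (prod.swap \<circ> \<gamma>) = prod.swap ` path_image \<gamma>" by (rule path_image_compose)
    then show "path_image (prod.swap \<circ> \<gamma>) \<subseteq> (\<Union>j\<in>J. {c j..d j} \<times> {v j}) \<union> {p. fst p \<in> h ` I}"
      using img by fastforce
  qed
  then show ?thesis using x by (simp add: l1_dist_def sum.distrib)
qed

section \<open>Isometries of the plane\<close>

text \<open>The origin is the only midpoint of \<open>(r, 0)\<close> and \<open>(-r, 0)\<close>. By surjectivity the same holds for their
images, which forces these to be opposite; likewise for \<open>(0, r)\<close> and \<open>(0, -r)\<close>. All four images have
norm \<open>r\<close> and mutual distance \<open>2 r\<close>, so their coordinates never have the same sign, and they are axis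
points again. Finally, a point of the square with half side \<open>r\<close> is determined by its distances to the four
axis points, since \<open>\<bar>s + r\<bar> - \<bar>s - r\<bar> = 2 s\<close> for \<open>\<bar>s\<bar> \<le> r\<close>.\<close>

lemma l1_isometry_on_square:
  fixes g :: "real \<times> real \<Rightarrow> real \<times> real"
  assumes iso: "\<And>u v. l1_dist (g u) (g v) = l1_dist u v" and "surj g" and g0: "g (0, 0) = (0, 0)"
    and r: "0 < r"
  shows "\<exists>\<sigma> \<tau>. \<bar>\<sigma>\<bar> = 1 \<and> \<bar>\<tau>\<bar> = 1 \<and>
     ((\<forall>s t. \<bar>s\<bar> \<le> r \<and> \<bar>t\<bar> \<le> r \<longrightarrow> g (s, t) = (\<sigma> * s, \<tau> * t)) \<or>
      (\<forall>s t. \<bar>s\<bar> \<le> r \<and> \<bar>t\<bar> \<le> r \<longrightarrow> g (s, t) = (\<sigma> * t, \<tau> * s)))"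
proof -
  have norm: "\<bar>fst (g u)\<bar> + \<bar>snd (g u)\<bar> = \<bar>fst u\<bar> + \<bar>snd u\<bar>" for u
    using iso[of u "(0, 0)"] by (simp add: l1_dist_def g0)
  have dist: "\<bar>fst (g u) - fst (g v)\<bar> + \<bar>snd (g u) - snd (g v)\<bar> = \<bar>fst u - fst v\<bar> + \<bar>snd u - snd v\<bar>" for u v
    using iso[of u v] by (simp add: l1_dist_def)
  have opp: "g v = (- fst (g u), - snd (g u))"
    if mid: "\<And>z. l1_dist u z = r \<Longrightarrow> l1_dist v z = r \<Longrightarrow> z = (0, 0)"
      and nu: "\<bar>fst u\<bar> + \<bar>snd u\<bar> = r" and nv: "\<bar>fst v\<bar> + \<bar>snd v\<bar> = r" for u v
  proof -
    \<comment> \<open>The sum of the two images has distance \<open>r\<close> from each of them, so it is the image of a midpoint.\<close>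
    obtain z where z: "g z = (fst (g u) + fst (g v), snd (g u) + snd (g v))"
      using \<open>surj g\<close> by (metis surjD)
    have "l1_dist (g u) (g z) = r" "l1_dist (g v) (g z) = r"
      using norm[of u] norm[of v] nu nv by (simp_all add: l1_dist_def z)
    then have "z = (0, 0)" using mid by (simp add: iso)
    then have "fst (g u) + fst (g v) = 0" "snd (g u) + snd (g v) = 0" using z g0 by simp_all
    then show ?thesis by (simp add: prod_eq_iff)
  qed
  define a b c d where "a = fst (g (r, 0))" and "b = snd (g (r, 0))"
    and "c = fst (g (0, r))" and "d = snd (g (0, r))"
  have p1: "g (r, 0) = (a, b)" and p3: "g (0, r) = (c, d)" by (simp_all add: a_def b_def c_def d_def)
  have p2: "g (- r, 0) = (- a, - b)"
    using opp[of "(r, 0)" "(- r, 0)"] r by (auto simp: l1_dist_def prod_eq_iff p1)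
  have p4: "g (0, - r) = (- c, - d)"
    using opp[of "(0, r)" "(0, - r)"] r by (auto simp: l1_dist_def prod_eq_iff p3)
  have n1: "\<bar>a\<bar> + \<bar>b\<bar> = r" and n3: "\<bar>c\<bar> + \<bar>d\<bar> = r"
    using norm[of "(r, 0)"] norm[of "(0, r)"] r by (simp_all add: p1 p3)
  have d13: "\<bar>a - c\<bar> + \<bar>b - d\<bar> = 2 * r" and d14: "\<bar>a + c\<bar> + \<bar>b + d\<bar> = 2 * r"
    using dist[of "(r, 0)" "(0, r)"] dist[of "(r, 0)" "(0, - r)"] r by (simp_all add: p1 p3 p4)
  have tri: "\<bar>a - c\<bar> \<le> \<bar>a\<bar> + \<bar>c\<bar>" "\<bar>b - d\<bar> \<le> \<bar>b\<bar> + \<bar>d\<bar>"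
    "\<bar>a + c\<bar> \<le> \<bar>a\<bar> + \<bar>c\<bar>" "\<bar>b + d\<bar> \<le> \<bar>b\<bar> + \<bar>d\<bar>" by linarith+
  have "\<bar>a - c\<bar> = \<bar>a\<bar> + \<bar>c\<bar>" "\<bar>b - d\<bar> = \<bar>b\<bar> + \<bar>d\<bar>"
    using d13 n1 n3 tri(1,2) by linarith+
  moreover have "\<bar>a + c\<bar> = \<bar>a\<bar> + \<bar>c\<bar>" "\<bar>b + d\<bar> = \<bar>b\<bar> + \<bar>d\<bar>"
    using d14 n1 n3 tri(3,4) by linarith+
  ultimately have "a = 0 \<or> c = 0" "b = 0 \<or> d = 0" by linarith+
  then have "(b = 0 \<and> c = 0) \<or> (a = 0 \<and> d = 0)" using n1 n3 r by auto
  then have cases: "(b = 0 \<and> c = 0 \<and> \<bar>a\<bar> = r \<and> \<bar>d\<bar> = r) \<or> (a = 0 \<and> d = 0 \<and> \<bar>b\<bar> = r \<and> \<bar>c\<bar> = r)"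
    using n1 n3 by auto
  have e: "\<bar>fst (g (s, t)) - a\<bar> + \<bar>snd (g (s, t)) - b\<bar> = \<bar>s - r\<bar> + \<bar>t\<bar>"
    "\<bar>fst (g (s, t)) + a\<bar> + \<bar>snd (g (s, t)) + b\<bar> = \<bar>s + r\<bar> + \<bar>t\<bar>"
    "\<bar>fst (g (s, t)) - c\<bar> + \<bar>snd (g (s, t)) - d\<bar> = \<bar>s\<bar> + \<bar>t - r\<bar>"
    "\<bar>fst (g (s, t)) + c\<bar> + \<bar>snd (g (s, t)) + d\<bar> = \<bar>s\<bar> + \<bar>t + r\<bar>"
    "\<bar>fst (g (s, t))\<bar> + \<bar>snd (g (s, t))\<bar> = \<bar>s\<bar> + \<bar>t\<bar>" for s t
    subgoal using dist[of "(s, t)" "(r, 0)"] by (simp add: p1)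
    subgoal using dist[of "(s, t)" "(- r, 0)"] by (simp add: p2)
    subgoal using dist[of "(s, t)" "(0, r)"] by (simp add: p3)
    subgoal using dist[of "(s, t)" "(0, - r)"] by (simp add: p4)
    subgoal using norm[of "(s, t)"] by simp
    done
  have solve: "x = (if A = r then s else - s) \<and> y = (if D = r then t else - t)"
    if "\<bar>A\<bar> = r" "\<bar>D\<bar> = r" "\<bar>s\<bar> \<le> r" "\<bar>t\<bar> \<le> r"
      "\<bar>x - A\<bar> + \<bar>y\<bar> = \<bar>s - r\<bar> + \<bar>t\<bar>" "\<bar>x + A\<bar> + \<bar>y\<bar> = \<bar>s + r\<bar> + \<bar>t\<bar>"
      "\<bar>x\<bar> + \<bar>y - D\<bar> = \<bar>s\<bar> + \<bar>t - r\<bar>" "\<bar>x\<bar> + \<bar>y + D\<bar> = \<bar>s\<bar> + \<bar>t + r\<bar>"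
      "\<bar>x\<bar> + \<bar>y\<bar> = \<bar>s\<bar> + \<bar>t\<bar>" for A D x y s t :: real
  proof -
    have A: "A = r \<or> A = - r" and D: "D = r \<or> D = - r" using that(1,2) by linarith+
    have st: "\<bar>s - r\<bar> = r - s" "\<bar>s + r\<bar> = r + s" "\<bar>t - r\<bar> = r - t" "\<bar>t + r\<bar> = r + t"
      using that(3,4) by (simp_all add: abs_le_iff)
    have "\<bar>x + A\<bar> - \<bar>x - A\<bar> = (\<bar>s + r\<bar> + \<bar>t\<bar>) - (\<bar>s - r\<bar> + \<bar>t\<bar>)"
      unfolding that(5,6)[symmetric] by simp
    then have xA: "\<bar>x + A\<bar> - \<bar>x - A\<bar> = 2 * s" unfolding st by simp
    have "\<bar>y + D\<bar> - \<bar>y - D\<bar> = (\<bar>s\<bar> + \<bar>t + r\<bar>) - (\<bar>s\<bar> + \<bar>t - r\<bar>)"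
      unfolding that(7,8)[symmetric] by simp
    then have yD: "\<bar>y + D\<bar> - \<bar>y - D\<bar> = 2 * t" unfolding st by simp
    have one: "z = (if B = r then w else - w)" if "B = r \<or> B = - r" "\<bar>z + B\<bar> - \<bar>z - B\<bar> = 2 * w" "\<bar>z\<bar> \<le> r"
      for B z w :: real
      using that r by auto
    have y: "\<bar>y\<bar> = \<bar>t\<bar>" if "\<bar>y\<bar> \<le> r" using one[OF D yD that] by auto
    have x: "\<bar>x\<bar> = \<bar>s\<bar>" if "\<bar>x\<bar> \<le> r" using one[OF A xA that] by auto
    have "\<bar>x\<bar> \<le> r" using y that(3,4,9) by linarith
    moreover have "\<bar>y\<bar> \<le> r" using x that(3,4,9) by linarith
    ultimately show ?thesis using one[OF A xA] one[OF D yD] by blast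
  qed
  let ?s = "\<lambda>A. if A = r then 1 else - 1 :: real"
  from cases show ?thesis
  proof
    assume *: "b = 0 \<and> c = 0 \<and> \<bar>a\<bar> = r \<and> \<bar>d\<bar> = r"
    have "g (s, t) = (?s a * s, ?s d * t)" if "\<bar>s\<bar> \<le> r" "\<bar>t\<bar> \<le> r" for s t
    proof -
      have ad: "\<bar>a\<bar> = r" "\<bar>d\<bar> = r" "b = 0" "c = 0" using * by auto
      note E = e[of s t, unfolded ad(3,4) diff_zero add_0_right]
      show ?thesis using solve[OF ad(1,2) that E] by (auto simp: prod_eq_iff)
    qed
    then show ?thesis by (intro exI[of _ "?s a"] exI[of _ "?s d"]) auto
  next
    assume *: "a = 0 \<and> d = 0 \<and> \<bar>b\<bar> = r \<and> \<bar>c\<bar> = r"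
    have "g (s, t) = (?s c * t, ?s b * s)" if "\<bar>s\<bar> \<le> r" "\<bar>t\<bar> \<le> r" for s t
    proof -
      have bc: "\<bar>b\<bar> = r" "\<bar>c\<bar> = r" "a = 0" "d = 0" using * by auto
      note E = e[of s t, unfolded bc(3,4) diff_zero add_0_right, THEN trans[OF add.commute]]
      show ?thesis using solve[OF bc(1,2) that E] by (auto simp: prod_eq_iff)
    qed
    then show ?thesis by (intro exI[of _ "?s c"] exI[of _ "?s b"]) auto
  qed
qed

text \<open>The descriptions on squares of different size agree, because they all determine the images of \<open>(1, 0)\<close>
and \<open>(0, 1)\<close>.\<close>

lemma l1_isometry_cases:
  assumes "l1_isometry f"
  obtains c1 c2 \<sigma> \<tau> where "\<bar>\<sigma>\<bar> = 1" "\<bar>\<tau>\<bar> = 1"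
    "f = axis_map c1 c2 \<sigma> \<tau> \<or> f = axis_map c1 c2 \<sigma> \<tau> \<circ> prod.swap"
proof -
  define c where "c = f (0, 0)"
  define g where "g u = (fst (f u) - fst c, snd (f u) - snd c)" for u
  have iso: "l1_dist (g u) (g v) = l1_dist u v" for u v
  proof -
    have "l1_dist (f u) (f v) = l1_dist u v" using assms unfolding l1_isometry_def by blast
    then show ?thesis by (simp add: g_def l1_dist_def)
  qed
  have "surj g"
    unfolding surj_def
  proof
    fix p
    obtain u where "f u = (fst p + fst c, snd p + snd c)"
      using assms unfolding l1_isometry_def by (metis surjD)
    then show "\<exists>u. p = g u" by (intro exI[of _ u]) (simp add: g_def)
  qed
  have g0: "g (0, 0) = (0, 0)" by (simp add: g_def c_def)
  note square = l1_isometry_on_square[of g, OF iso \<open>surj g\<close> g0]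
  obtain \<sigma> \<tau> where st: "\<bar>\<sigma>\<bar> = 1" "\<bar>\<tau>\<bar> = 1"
    and unit: "(\<forall>s t. \<bar>s\<bar> \<le> 1 \<and> \<bar>t\<bar> \<le> 1 \<longrightarrow> g (s, t) = (\<sigma> * s, \<tau> * t)) \<or>
      (\<forall>s t. \<bar>s\<bar> \<le> 1 \<and> \<bar>t\<bar> \<le> 1 \<longrightarrow> g (s, t) = (\<sigma> * t, \<tau> * s))"
    using square[of 1] by auto
  have nz: "\<sigma> \<noteq> 0" "\<tau> \<noteq> 0" using st by auto
  have f_g: "f u = (fst c + fst (g u), snd c + snd (g u))" for u by (simp add: g_def)
  have large: "\<exists>\<sigma>' \<tau>'. (g (s, t) = (\<sigma>' * s, \<tau>' * t) \<and> g (1, 0) = (\<sigma>', 0) \<and> g (0, 1) = (0, \<tau>')) \<or>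
      (g (s, t) = (\<sigma>' * t, \<tau>' * s) \<and> g (1, 0) = (0, \<tau>') \<and> g (0, 1) = (\<sigma>', 0))" for s t
  proof -
    have "0 < \<bar>s\<bar> + \<bar>t\<bar> + 1" by simp
    from square[OF this] obtain \<sigma>' \<tau>' where
      "(\<forall>x y. \<bar>x\<bar> \<le> \<bar>s\<bar> + \<bar>t\<bar> + 1 \<and> \<bar>y\<bar> \<le> \<bar>s\<bar> + \<bar>t\<bar> + 1 \<longrightarrow> g (x, y) = (\<sigma>' * x, \<tau>' * y)) \<or>
       (\<forall>x y. \<bar>x\<bar> \<le> \<bar>s\<bar> + \<bar>t\<bar> + 1 \<and> \<bar>y\<bar> \<le> \<bar>s\<bar> + \<bar>t\<bar> + 1 \<longrightarrow> g (x, y) = (\<sigma>' * y, \<tau>' * x))"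
      by blast
    then show ?thesis by (intro exI[of _ \<sigma>'] exI[of _ \<tau>']) auto
  qed
  from unit show ?thesis
  proof
    assume u: "\<forall>s t. \<bar>s\<bar> \<le> 1 \<and> \<bar>t\<bar> \<le> 1 \<longrightarrow> g (s, t) = (\<sigma> * s, \<tau> * t)"
    have "g (1, 0) = (\<sigma>, 0)" "g (0, 1) = (0, \<tau>)" using u by auto
    then have "g (s, t) = (\<sigma> * s, \<tau> * t)" for s t
      using large[of s t] nz by auto
    then have "f = axis_map (fst c) (snd c) \<sigma> \<tau>" by (auto simp: f_g axis_map_def fun_eq_iff)
    then show ?thesis using that st by blast
  next
    assume u: "\<forall>s t. \<bar>s\<bar> \<le> 1 \<and> \<bar>t\<bar> \<le> 1 \<longrightarrow> g (s, t) = (\<sigma> * t, \<tau> * s)"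
    have "g (1, 0) = (0, \<tau>)" "g (0, 1) = (\<sigma>, 0)" using u by auto
    then have "g (s, t) = (\<sigma> * t, \<tau> * s)" for s t
      using large[of s t] nz by auto
    then have "f = axis_map (fst c) (snd c) \<sigma> \<tau> \<circ> prod.swap" by (auto simp: f_g axis_map_def fun_eq_iff)
    then show ?thesis using that st by blast
  qed
qed

lemma similar_toD:
  assumes "similar_to A M"
  obtains c1 c2 k1 k2 R where "0 < R" "\<bar>k1\<bar> = R" "\<bar>k2\<bar> = R"
    "A = axis_map c1 c2 k1 k2 ` M \<or> A = axis_map c1 c2 k1 k2 ` prod.swap ` M"
proof -
  obtain p r f where r: "r \<noteq> 0" and f: "l1_isometry f" and A: "A = f ` (\<lambda>x. p + r *\<^sub>R (x - p)) ` M"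
    using assms unfolding similar_to_def homothety_def by blast
  obtain c1 c2 \<sigma> \<tau> where st: "\<bar>\<sigma>\<bar> = 1" "\<bar>\<tau>\<bar> = 1"
    "f = axis_map c1 c2 \<sigma> \<tau> \<or> f = axis_map c1 c2 \<sigma> \<tau> \<circ> prod.swap"
    by (rule l1_isometry_cases[OF f])
  from st(3) show ?thesis
  proof
    assume f: "f = axis_map c1 c2 \<sigma> \<tau>"
    have "A = axis_map (c1 + \<sigma> * (1 - r) * fst p) (c2 + \<tau> * (1 - r) * snd p) (\<sigma> * r) (\<tau> * r) ` M"
      unfolding A f image_image by (intro image_cong) (auto simp: axis_map_def algebra_simps)
    then show ?thesis
      by (intro that[of "\<bar>r\<bar>" "\<sigma> * r" "\<tau> * r"] disjI1) (use r st(1,2) in \<open>auto simp: abs_mult\<close>)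
  next
    assume f: "f = axis_map c1 c2 \<sigma> \<tau> \<circ> prod.swap"
    have "A = axis_map (c1 + \<sigma> * (1 - r) * snd p) (c2 + \<tau> * (1 - r) * fst p) (\<sigma> * r) (\<tau> * r) ` prod.swap ` M"
      unfolding A f image_image by (intro image_cong) (auto simp: axis_map_def algebra_simps)
    then show ?thesis
      by (intro that[of "\<bar>r\<bar>" "\<sigma> * r" "\<tau> * r"] disjI2) (use r st(1,2) in \<open>auto simp: abs_mult\<close>)
  qed
qed

section \<open>The distance to squares\<close>

abbreviation sq_dist2 :: "(real \<times> real) set \<Rightarrow> real" where
  "sq_dist2 A \<equiv> INF S\<in>{S. is_square S}. (d_inf A S)\<^sup>2"

lemma exists_square: "\<exists>S. is_square S"
  unfolding is_square_def by (metis zero_less_one)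

lemma sq_dist2_nonneg: "0 \<le> sq_dist2 A"
  using exists_square by (intro cINF_greatest) auto

lemma far_from_squares_sq_dist: "far_from_squares A (sqrt (sq_dist2 A))"
  unfolding far_from_squares_def
proof (intro allI impI notI)
  fix l S assume l: "0 \<le> l \<and> l < sqrt (sq_dist2 A) \<and> is_square S"
    and S: "A \<subseteq> S + B_inf l \<and> S \<subseteq> A + B_inf l"
  let ?X = "{l. 0 \<le> l \<and> A \<subseteq> S + B_inf l \<and> S \<subseteq> A + B_inf l}"
  have "l \<in> ?X" using l S by blast
  then have "d_inf A S \<le> l" "0 \<le> d_inf A S"
    unfolding d_inf_def by (auto intro!: cInf_lower cInf_greatest bdd_belowI[of _ 0])
  then have "(d_inf A S)\<^sup>2 \<le> l\<^sup>2" by (rule power_mono)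
  moreover have "sq_dist2 A \<le> (d_inf A S)\<^sup>2"
    using l by (intro cINF_lower bdd_belowI2[of _ 0]) auto
  moreover have "l\<^sup>2 < sq_dist2 A"
    using l sq_dist2_nonneg[of A] power_strict_mono[of l "sqrt (sq_dist2 A)" 2] by simp
  ultimately show False by linarith
qed

lemma sq_dist2_ge:
  assumes A: "compact A" "A \<noteq> {}" and "0 \<le> m"
    and ge: "\<And>S l. is_square S \<Longrightarrow> 0 \<le> l \<Longrightarrow> A \<subseteq> S + B_inf l \<Longrightarrow> S \<subseteq> A + B_inf l \<Longrightarrow> m \<le> l"
  shows "m\<^sup>2 \<le> sq_dist2 A"
proof (rule cINF_greatest)
  show "{S. is_square S} \<noteq> {}" using exists_square by blast
  fix S assume "S \<in> {S. is_square S}"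
  then have S: "is_square S" by simp
  then obtain a b s where ab: "0 < s" "S = {a..a + s} \<times> {b..b + s}" unfolding is_square_def by blast
  then have "S = cbox (a, b) (a + s, b + s)" by (simp add: cbox_Pair_eq)
  then have "bounded (A \<union> S)" using A(1) by (simp add: compact_imp_bounded)
  then obtain K where K: "\<And>p. p \<in> A \<union> S \<Longrightarrow> norm p \<le> K" unfolding bounded_iff by blast
  have near: "\<bar>fst p - fst q\<bar> \<le> 2 * K \<and> \<bar>snd p - snd q\<bar> \<le> 2 * K" if "p \<in> A \<union> S" "q \<in> A \<union> S" for p q
  proof -
    have "norm (p - q) \<le> 2 * K" using K[OF that(1)] K[OF that(2)] norm_triangle_ineq4[of p q] by linarith
    then show ?thesis using dist_fst_le[of p q] dist_snd_le[of p q] by (simp add: dist_norm)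
  qed
  obtain p q where "p \<in> A" "q \<in> S" using A(2) ab by fastforce
  then have ne: "2 * K \<in> {l. 0 \<le> l \<and> A \<subseteq> S + B_inf l \<and> S \<subseteq> A + B_inf l}"
    using near by (fastforce simp: subset_iff mem_plus_B_inf)
  have "m \<le> d_inf A S"
    unfolding d_inf_def by (rule cInf_greatest) (use ne ge[OF S] in auto)
  then show "m\<^sup>2 \<le> (d_inf A S)\<^sup>2" using \<open>0 \<le> m\<close> by (rule power_mono)
qed

text \<open>Both sides of the box differ from the side of the square by at most \<open>2 l\<close>.\<close>

lemma square_near_box:
  assumes tb: "tight_box A x0 x1 y0 y1" and S: "is_square S" and near: "A \<subseteq> S + B_inf l" "S \<subseteq> A + B_inf l"
  shows "\<bar>(y1 - y0) - (x1 - x0)\<bar> \<le> 4 * l"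
proof -
  obtain a b s where ab: "0 < s" "S = {a..a + s} \<times> {b..b + s}" using S unfolding is_square_def by blast
  have inS: "a - l \<le> fst p \<and> fst p \<le> a + s + l \<and> b - l \<le> snd p \<and> snd p \<le> b + s + l" if "p \<in> A" for p
    using near(1) that unfolding ab by (force simp: mem_plus_B_inf)
  have inA: "x0 - l \<le> fst p \<and> fst p \<le> x1 + l \<and> y0 - l \<le> snd p \<and> snd p \<le> y1 + l" if "p \<in> S" for p
  proof -
    have "p \<in> A + B_inf l" using near(2) that by blast
    then obtain q where "q \<in> A" "\<bar>fst p - fst q\<bar> \<le> l" "\<bar>snd p - snd q\<bar> \<le> l"
      unfolding mem_plus_B_inf by blast
    then show ?thesis using tb by (auto simp: tight_box_def abs_le_iff)
  qed
  obtain p1 p2 p3 p4 where "p1 \<in> A" "fst p1 = x0" "p2 \<in> A" "fst p2 = x1" "p3 \<in> A" "snd p3 = y0" "p4 \<in> A" "snd p4 = y1"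
    using tb unfolding tight_box_def by blast
  then have "a - l \<le> x0" "x1 \<le> a + s + l" "b - l \<le> y0" "y1 \<le> b + s + l" using inS by blast+
  moreover have "x0 - l \<le> a" "a + s \<le> x1 + l" "y0 - l \<le> b" "b + s \<le> y1 + l"
    using inA[of "(a, b)"] inA[of "(a + s, b + s)"] ab by auto
  ultimately show ?thesis by linarith
qed

text \<open>Let \<open>z\<close> be the corner of the square on the side of the notch. As \<open>A\<close> reaches all sides of its bounding
box, \<open>z\<close> is at most \<open>l\<close> short of the corner of that box in either direction. A point of \<open>A\<close> near \<open>z\<close> is
then at most \<open>2 l\<close> short, and the notch excludes this for \<open>l < R * \<delta>\<close>.\<close>

lemma square_near_notched:
  assumes A: "A = axis_map c1 c2 k1 k2 ` notched_square \<delta>" and k: "0 < R" "\<bar>k1\<bar> = R" "\<bar>k2\<bar> = R"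
    and \<delta>: "0 \<le> \<delta>" "\<delta> < 1 / 2" and S: "is_square S" and near: "A \<subseteq> S + B_inf l" "S \<subseteq> A + B_inf l"
  shows "R * \<delta> \<le> l"
proof -
  obtain a b s where ab: "0 < s" "S = {a..a + s} \<times> {b..b + s}" using S unfolding is_square_def by blast
  have inS: "a - l \<le> fst p \<and> fst p \<le> a + s + l \<and> b - l \<le> snd p \<and> snd p \<le> b + s + l" if "p \<in> A" for p
    using near(1) that unfolding ab by (force simp: mem_plus_B_inf)
  have "(1, 0) \<in> notched_square \<delta>" "(0, 1) \<in> notched_square \<delta>"
    using \<delta> by (auto simp: notched_square_def)
  then have "axis_map c1 c2 k1 k2 (1, 0) \<in> A" "axis_map c1 c2 k1 k2 (0, 1) \<in> A"
    unfolding A by blast+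
  then have far: "a - l \<le> c1 + k1" "c1 + k1 \<le> a + s + l" "b - l \<le> c2 + k2" "c2 + k2 \<le> b + s + l"
    using inS by (force simp: axis_map_def)+
  define z where "z = (if 0 < k1 then a + s else a, if 0 < k2 then b + s else b)"
  have "z \<in> S" using ab by (auto simp: z_def)
  then have "z \<in> A + B_inf l" using near(2) by blast
  then obtain q where "q \<in> A" and q: "\<bar>fst z - fst q\<bar> \<le> l" "\<bar>snd z - snd q\<bar> \<le> l"
    unfolding mem_plus_B_inf by blast
  then obtain u v where uv: "(u, v) \<in> notched_square \<delta>" "q = (c1 + k1 * u, c2 + k2 * v)"
    unfolding A by (auto simp: axis_map_def)
  have side: "R * (1 - w) \<le> 2 * l"
    if "\<bar>k\<bar> = R" "\<bar>(if 0 < k then y + s else y) - (c + k * w)\<bar> \<le> l" "y - l \<le> c + k" "c + k \<le> y + s + l"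
    for k y c w
  proof (cases "0 < k")
    case True
    then have "k = R" using that(1) by simp
    then have "R - R * w \<le> 2 * l" using that(2-4) True by auto
    then show ?thesis by (simp add: algebra_simps)
  next
    case False
    then have kR: "k = - R" using that(1) by simp
    then have "R - R * w \<le> 2 * l" using that(2-4) False by auto
    then show ?thesis by (simp add: algebra_simps)
  qed
  have "R * (1 - u) \<le> 2 * l"
    by (rule side[OF k(2) _ far(1,2)]) (use q(1) uv(2) in \<open>simp add: z_def\<close>)
  moreover have "R * (1 - v) \<le> 2 * l"
    by (rule side[OF k(3) _ far(3,4)]) (use q(2) uv(2) in \<open>simp add: z_def\<close>)
  moreover have "2 * \<delta> \<le> 1 - u \<or> 2 * \<delta> \<le> 1 - v" using uv(1) by (auto simp: notched_square_def)
  then have "R * (2 * \<delta>) \<le> R * (1 - u) \<or> R * (2 * \<delta>) \<le> R * (1 - v)"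
    using k(1) by (metis mult_left_mono less_imp_le)
  ultimately show ?thesis by linarith
qed

section \<open>Area and length of the extremal shapes\<close>

lemma affine_image_interval_length:
  fixes k c u :: real
  assumes "0 \<le> u"
  obtains p where "(\<lambda>x. k * x + c) ` {0..u} = {p..p + \<bar>k\<bar> * u}"
proof (cases "0 \<le> k")
  case True
  then show ?thesis using affine_image_interval(1)[OF assms True, of c] that[of c] by simp
next
  case False
  then have "k < 0" by simp
  then show ?thesis using affine_image_interval(2)[OF assms \<open>k < 0\<close>, of c] that[of "c + k * u"] by simp
qed

lemma measure_axis_image_rect:
  assumes "0 \<le> u" "0 \<le> v"
  shows "measure lebesgue (axis_map c1 c2 k1 k2 ` ({0..u} \<times> {0..v})) = (\<bar>k1\<bar> * u) * (\<bar>k2\<bar> * v)"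
    and "axis_map c1 c2 k1 k2 ` ({0..u} \<times> {0..v}) \<in> lmeasurable"
proof -
  obtain p where p: "(\<lambda>x. k1 * x + c1) ` {0..u} = {p..p + \<bar>k1\<bar> * u}"
    using affine_image_interval_length[OF assms(1)] .
  obtain q where q: "(\<lambda>x. k2 * x + c2) ` {0..v} = {q..q + \<bar>k2\<bar> * v}"
    using affine_image_interval_length[OF assms(2)] .
  have nn: "0 \<le> \<bar>k1\<bar> * u" "0 \<le> \<bar>k2\<bar> * v" using assms by auto
  show "measure lebesgue (axis_map c1 c2 k1 k2 ` ({0..u} \<times> {0..v})) = (\<bar>k1\<bar> * u) * (\<bar>k2\<bar> * v)"
    unfolding axis_map_image_Times p q using nn by (subst measure_rect) auto
  show "axis_map c1 c2 k1 k2 ` ({0..u} \<times> {0..v}) \<in> lmeasurable"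
    unfolding axis_map_image_Times p q using nn by (intro measure_rect) auto
qed

lemma measure_axis_image_notched:
  assumes k: "\<bar>k1\<bar> = R" "\<bar>k2\<bar> = R" "0 < R" and \<delta>: "0 \<le> \<delta>" "\<delta> < 1 / 2"
  shows "measure lebesgue (axis_map c1 c2 k1 k2 ` notched_square \<delta>) = R\<^sup>2 * (1 - 4 * \<delta>\<^sup>2)"
proof -
  let ?g = "axis_map c1 c2 k1 k2"
  let ?B = "{0..1} \<times> {0..1 - 2 * \<delta>}" and ?C = "{0..1 - 2 * \<delta>} \<times> {0..1}"
  have "inj ?g" using k by (auto simp: inj_def axis_map_def prod_eq_iff)
  then have int: "?g ` ?B \<inter> ?g ` ?C = ?g ` ({0..1 - 2 * \<delta>} \<times> {0..1 - 2 * \<delta>})"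
    using \<delta> by (subst image_Int[symmetric]) (auto intro!: image_cong)
  have nn: "0 \<le> 1 - 2 * \<delta>" using \<delta> by simp
  have "measure lebesgue (?g ` ?B \<union> ?g ` ?C)
      = measure lebesgue (?g ` ?B) + measure lebesgue (?g ` ?C) - measure lebesgue (?g ` ?B \<inter> ?g ` ?C)"
    by (intro measure_Un3 measure_axis_image_rect(2)) (use nn in auto)
  also have "\<dots> = R\<^sup>2 * (1 - 4 * \<delta>\<^sup>2)"
    unfolding int using nn
    by (simp add: measure_axis_image_rect k power2_eq_square) (simp add: algebra_simps)
  finally show ?thesis unfolding notched_square_union[OF \<delta>] image_Un .
qed

text \<open>Pulling \<open>\<gamma>\<close> back along the similarity divides its length by \<open>R\<close> and places it on the frontier of \<open>M\<close>,
which is contained in \<open>M - G\<close>.\<close>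

lemma axis_image_length_le:
  fixes a b h :: "'i \<Rightarrow> real" and c d v :: "'j \<Rightarrow> real"
  assumes \<gamma>: "simple_path \<gamma>" "path_image \<gamma> = frontier A" and "closed A"
    and A: "A = axis_map c1 c2 k1 k2 ` M" and k: "0 < R" "\<bar>k1\<bar> = R" "\<bar>k2\<bar> = R"
    and fin: "finite I" "finite J"
    and ab: "\<And>i. i \<in> I \<Longrightarrow> a i \<le> b i" and cd: "\<And>j. j \<in> J \<Longrightarrow> c j \<le> d j"
    and G: "open G" "G \<subseteq> M" "M - G \<subseteq> (\<Union>i\<in>I. {a i..b i} \<times> {h i}) \<union> (\<Union>j\<in>J. {v j} \<times> {c j..d j})"
  shows "l1_length \<gamma> \<le> R * ((\<Sum>i\<in>I. b i - a i) + (\<Sum>j\<in>J. d j - c j))"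
proof -
  let ?g = "axis_map c1 c2 k1 k2"
  define g' where "g' p = ((fst p - c1) / k1, (snd p - c2) / k2)" for p
  have nz: "k1 \<noteq> 0" "k2 \<noteq> 0" using k by auto
  have gg': "?g (g' p) = p" "g' (?g p) = p" for p
    using nz by (simp_all add: axis_map_def g'_def)
  have cont: "continuous_on UNIV g'" unfolding g'_def by (intro continuous_intros) (use nz in auto)
  have fr: "g' p \<in> M - G" if "p \<in> frontier A" for p
  proof
    have p: "p \<in> A" "p \<notin> interior A" using that \<open>closed A\<close> by (auto simp: frontier_def)
    then show "g' p \<in> M" unfolding A by (auto simp: gg')
    show "g' p \<notin> G"
    proof
      assume "g' p \<in> G"
      have "open (g' -` G)" using cont G(1) by (simp add: continuous_on_open_vimage)
      moreover have "g' -` G \<subseteq> A" unfolding A using G(2) gg'(1) by (metis image_eqI subsetI subsetD vimageE)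
      ultimately have "g' -` G \<subseteq> interior A" by (simp add: interior_maximal)
      then show False using p(2) \<open>g' p \<in> G\<close> by blast
    qed
  qed
  have simple: "simple_path (g' \<circ> \<gamma>)"
  proof -
    have "path (g' \<circ> \<gamma>)"
      using \<gamma>(1) cont by (auto simp: simple_path_def intro!: path_continuous_image continuous_on_subset[OF cont])
    moreover have "\<gamma> x = \<gamma> y" if "g' (\<gamma> x) = g' (\<gamma> y)" for x y using that gg'(1) by metis
    then have "loop_free (g' \<circ> \<gamma>)"
      using \<gamma>(1) unfolding simple_path_def loop_free_def o_def by blast
    ultimately show ?thesis by (simp add: simple_path_def)
  qed
  have img: "path_image (g' \<circ> \<gamma>) \<subseteq> (\<Union>i\<in>I. {a i..b i} \<times> {h i}) \<union> (\<Union>j\<in>J. {v j} \<times> {c j..d j})"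
    unfolding path_image_compose \<gamma>(2) using fr G(3) by blast
  have scale: "l1_dist p q = R * l1_dist (g' p) (g' q)" for p q
  proof -
    have "l1_dist (?g u) (?g w) = R * l1_dist u w" for u w
      using k by (simp add: l1_dist_def axis_map_def abs_mult distrib_left flip: right_diff_distrib)
    from this[of "g' p" "g' q"] show ?thesis by (simp add: gg')
  qed
  have "(\<Sum>i<n. l1_dist (\<gamma> (t i)) (\<gamma> (t (Suc i)))) \<le> R * ((\<Sum>i\<in>I. b i - a i) + (\<Sum>j\<in>J. d j - c j))"
    if t: "mono_on {..n} t" "t ` {..n} \<subseteq> {0..1}" for n t
  proof -
    have "(\<Sum>i<n. l1_dist (\<gamma> (t i)) (\<gamma> (t (Suc i)))) = R * (\<Sum>i<n. l1_dist ((g' \<circ> \<gamma>) (t i)) ((g' \<circ> \<gamma>) (t (Suc i))))"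
      by (simp add: sum_distrib_left scale[symmetric])
    also have "\<dots> \<le> R * ((\<Sum>i\<in>I. b i - a i) + (\<Sum>j\<in>J. d j - c j))"
      using simple_path_grid_length_le[OF simple fin ab cd img t] k(1) by simp
    finally show ?thesis .
  qed
  moreover have "l1_inscribed_lengths \<gamma> \<noteq> {}"
  proof -
    have "mono_on {..0} (\<lambda>i::nat. 0::real)" "(\<lambda>i::nat. 0::real) ` {..0} \<subseteq> {0..1}" by (auto simp: mono_on_def)
    then show ?thesis unfolding l1_inscribed_lengths_def by blast
  qed
  ultimately show ?thesis
    unfolding l1_length_def by (intro cSup_least) (auto simp: l1_inscribed_lengths_def)
qed

lemma axis_image_rect_length_le:
  assumes \<gamma>: "simple_path \<gamma>" "path_image \<gamma> = frontier A" and "closed A"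
    and A: "A = axis_map c1 c2 k1 k2 ` ({0..u} \<times> {0..w})" and k: "0 < R" "\<bar>k1\<bar> = R" "\<bar>k2\<bar> = R"
    and uw: "0 \<le> u" "0 \<le> w"
  shows "l1_length \<gamma> \<le> R * (2 * u + 2 * w)"
proof -
  let ?h = "\<lambda>i::nat. if i = 0 then 0 else w" and ?v = "\<lambda>i::nat. if i = 0 then 0 else u"
  have "l1_length \<gamma> \<le> R * ((\<Sum>i\<in>{0, 1::nat}. u - 0) + (\<Sum>j\<in>{0, 1::nat}. w - 0))"
  proof (rule axis_image_length_le[OF \<gamma> \<open>closed A\<close> A k])
    show "open ({0<..<u} \<times> {0<..<w})" by (intro open_Times) auto
    show "{0<..<u} \<times> {0<..<w} \<subseteq> {0..u} \<times> {0..w}" by auto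
    show "{0..u} \<times> {0..w} - {0<..<u} \<times> {0<..<w}
      \<subseteq> (\<Union>i\<in>{0, 1}. {0..u} \<times> {?h i}) \<union> (\<Union>j\<in>{0, 1}. {?v j} \<times> {0..w})"
      by auto
  qed (use uw in auto)
  then show ?thesis by simp
qed

lemma axis_image_notched_length_le:
  assumes \<gamma>: "simple_path \<gamma>" "path_image \<gamma> = frontier A" and "closed A"
    and A: "A = axis_map c1 c2 k1 k2 ` notched_square \<delta>" and k: "0 < R" "\<bar>k1\<bar> = R" "\<bar>k2\<bar> = R"
    and \<delta>: "0 \<le> \<delta>" "\<delta> < 1 / 2"
  shows "l1_length \<gamma> \<le> R * 4"
proof -
  define e where "e = 1 - 2 * \<delta>"
  have e: "0 < e" "e \<le> 1" using \<delta> by (auto simp: e_def)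
  \<comment> \<open>The sides at height \<open>0\<close>, \<open>e\<close> and \<open>1\<close>; by symmetry the same data describe the vertical sides.\<close>
  let ?a = "\<lambda>i::nat. if i = 1 then e else 0" and ?b = "\<lambda>i::nat. if i = 2 then e else 1"
  let ?h = "\<lambda>i::nat. if i = 0 then 0 else if i = 1 then e else 1"
  have "l1_length \<gamma> \<le> R * ((\<Sum>i\<in>{0, 1, 2}. ?b i - ?a i) + (\<Sum>j\<in>{0, 1, 2}. ?b j - ?a j))"
  proof (rule axis_image_length_le[OF \<gamma> \<open>closed A\<close> A k])
    let ?G = "{0<..<1} \<times> {0<..<e} \<union> {0<..<e} \<times> {0<..<1}"
    show "open ?G" by (intro open_Un open_Times) auto
    show "?G \<subseteq> notched_square \<delta>" using e unfolding notched_square_union[OF \<delta>] e_def[symmetric] by auto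
    show "notched_square \<delta> - ?G
      \<subseteq> (\<Union>i\<in>{0, 1, 2}. {?a i..?b i} \<times> {?h i}) \<union> (\<Union>j\<in>{0, 1, 2}. {?h j} \<times> {?a j..?b j})"
      using e unfolding notched_square_union[OF \<delta>] e_def[symmetric] by auto
  qed (use e in auto)
  also have "(\<Sum>i\<in>{0, 1, 2}. ?b i - ?a i) + (\<Sum>j\<in>{0, 1, 2}. ?b j - ?a j) = 4" by simp
  finally show ?thesis .
qed

section \<open>The equality case\<close>

lemma l1_isoperimetric_bound:
  assumes A: "compact A" "connected A" and tb: "tight_box A x0 x1 y0 y1"
    and \<gamma>: "jordan_curve \<gamma>" "path_image \<gamma> = frontier A" "l1_rectifiable \<gamma>"
  shows "measure lebesgue A \<le> (l1_length \<gamma> / 4)\<^sup>2 - 4 * sq_dist2 A"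
    and "measure lebesgue A = (l1_length \<gamma> / 4)\<^sup>2 - 4 * sq_dist2 A \<Longrightarrow>
      l1_length \<gamma> \<le> 2 * (x1 - x0) + 2 * (y1 - y0) \<and>
      measure lebesgue A = (((x1 - x0) + (y1 - y0)) / 2)\<^sup>2 - 4 * sq_dist2 A"
proof -
  let ?E = "sq_dist2 A" and ?V = "measure lebesgue A" and ?p = "((x1 - x0) + (y1 - y0)) / 2"
  have le: "?V \<le> ?p\<^sup>2 - 4 * ?E"
    using area_bound(1)[OF A tb far_from_squares_sq_dist] sq_dist2_nonneg[of A] by simp
  have p0: "0 \<le> ?p" using tb by (auto simp: tight_box_def)
  have per: "?p \<le> l1_length \<gamma> / 4" using tight_box_perimeter[OF A(1) tb \<gamma>] by (simp add: field_simps)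
  then have sq: "?p\<^sup>2 \<le> (l1_length \<gamma> / 4)\<^sup>2" using p0 by (rule power_mono)
  show "?V \<le> (l1_length \<gamma> / 4)\<^sup>2 - 4 * ?E" using le sq by linarith
  assume eq: "?V = (l1_length \<gamma> / 4)\<^sup>2 - 4 * ?E"
  then have "(l1_length \<gamma> / 4)\<^sup>2 \<le> ?p\<^sup>2" using le by linarith
  then have "l1_length \<gamma> / 4 \<le> ?p" using p0 by (rule power2_le_imp_le)
  then have "l1_length \<gamma> \<le> 2 * (x1 - x0) + 2 * (y1 - y0)" by (simp add: field_simps)
  then show "l1_length \<gamma> \<le> 2 * (x1 - x0) + 2 * (y1 - y0) \<and> ?V = ?p\<^sup>2 - 4 * ?E"
    using eq le sq by linarith
qed

lemma equality_imp_extremal: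
  assumes dom: "is_domain A"
    and \<gamma>: "jordan_curve \<gamma>" "path_image \<gamma> = frontier A" "l1_rectifiable \<gamma>"
    and eq: "measure lebesgue A = (l1_length \<gamma> / 4)\<^sup>2 - 4 * sq_dist2 A"
  shows "(\<exists>\<alpha>. 0 \<le> \<alpha> \<and> \<alpha> < 1 / 2 \<and> similar_to A (rect_R \<alpha>)) \<or>
    (\<exists>\<delta>. 0 \<le> \<delta> \<and> \<delta> < 1 / 2 \<and> similar_to A (notched_square \<delta>))"
proof -
  note A = is_domain_props[OF dom]
  have "A \<noteq> {}" using A(4) interior_subset by blast
  then obtain x0 x1 y0 y1 where tb: "tight_box A x0 x1 y0 y1"
    using compact_has_tight_box[OF A(1)] by blast
  have x01: "x0 < x1" "y0 < y1" using tight_box_interior[OF tb] A(4) by fastforce+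
  let ?l = "sqrt (sq_dist2 A)"
  have l: "0 \<le> ?l" "?l\<^sup>2 = sq_dist2 A" using sq_dist2_nonneg[of A] by auto
  note bd = l1_isoperimetric_bound(2)[OF A(1,2) tb \<gamma> eq]
  have "measure lebesgue A = (((x1 - x0) + (y1 - y0)) / 2)\<^sup>2 - 4 * ?l\<^sup>2" using bd l(2) by simp
  from area_bound(2)[OF A(1,2) tb far_from_squares_sq_dist l(1) this]
  consider (full) "measure lebesgue A = (x1 - x0) * (y1 - y0)"
    | (notch) x y where "0 < ?l" "x1 - x0 = y1 - y0" "measure lebesgue A = (x1 - x0) * (y1 - y0) - 4 * ?l\<^sup>2"
        "x0 + ?l \<le> x" "x \<le> x1 - ?l" "y0 + ?l \<le> y" "y \<le> y1 - ?l" "misses A ?l x y"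
    by blast
  then show ?thesis
  proof cases
    case full
    then have "A = {x0..x1} \<times> {y0..y1}" using full_box[OF A(1) tb x01] by blast
    then show ?thesis using rect_similar_rect_R[OF x01] by simp
  next
    case notch
    note int = interior_box_minus_square[OF A(1) tb A(3) notch(1,4-8,3)]
    have corner: "x = x0 + ?l \<or> x = x1 - ?l" "y = y0 + ?l \<or> y = y1 - ?l"
      using missed_square_at_corner[OF A(1,3) tb \<gamma> _ notch(1,4-8) int] bd by blast+
    have "2 * ?l < x1 - x0"
    proof (rule ccontr)
      assume "\<not> 2 * ?l < x1 - x0"
      then have "x - ?l = x0" "x + ?l = x1" "y - ?l = y0" "y + ?l = y1" using notch(2,4-7) by linarith+
      then have "interior A = {}" unfolding int by auto
      then show False using A(4) by simp
    qed
    then show ?thesis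
      using corner_notch_similar_notched_square[OF A(3) notch(1) _ notch(2) corner int] by blast
  qed
qed

text \<open>The hypotheses give \<open>(P / 4)\<^sup>2 - V \<le> 4 (R m)\<^sup>2 \<le> 4 l\<^sup>2\<close>, and the general inequality is the reverse.\<close>

lemma extremal_imp_equality:
  assumes dom: "is_domain A"
    and \<gamma>: "jordan_curve \<gamma>" "path_image \<gamma> = frontier A" "l1_rectifiable \<gamma>"
    and R: "0 < R" "0 \<le> m" "l1_length \<gamma> \<le> 4 * R" "measure lebesgue A = R\<^sup>2 * (1 - 4 * m\<^sup>2)"
    and near: "\<And>S l. is_square S \<Longrightarrow> 0 \<le> l \<Longrightarrow> A \<subseteq> S + B_inf l \<Longrightarrow> S \<subseteq> A + B_inf l \<Longrightarrow> R * m \<le> l"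
  shows "measure lebesgue A = (l1_length \<gamma> / 4)\<^sup>2 - 4 * sq_dist2 A"
proof -
  note A = is_domain_props[OF dom]
  have ne: "A \<noteq> {}" using A(4) interior_subset by blast
  then obtain x0 x1 y0 y1 where tb: "tight_box A x0 x1 y0 y1"
    using compact_has_tight_box[OF A(1)] by blast
  have "0 \<le> l1_length \<gamma>"
    using tight_box_perimeter[OF A(1) tb \<gamma>] tb by (auto simp: tight_box_def)
  then have "(l1_length \<gamma> / 4)\<^sup>2 \<le> R\<^sup>2" using R(3) by (intro power_mono) auto
  moreover have "(R * m)\<^sup>2 \<le> sq_dist2 A"
    by (rule sq_dist2_ge[OF A(1) ne]) (use R(1,2) near in auto)
  moreover have "measure lebesgue A \<le> (l1_length \<gamma> / 4)\<^sup>2 - 4 * sq_dist2 A"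
    by (rule l1_isoperimetric_bound(1)[OF A(1,2) tb \<gamma>])
  moreover have "R\<^sup>2 * (1 - 4 * m\<^sup>2) = R\<^sup>2 - 4 * (R * m)\<^sup>2"
    by (simp add: power_mult_distrib algebra_simps)
  ultimately show ?thesis using R(4) by linarith
qed

lemma similar_rect_equality:
  assumes dom: "is_domain A"
    and \<gamma>: "jordan_curve \<gamma>" "path_image \<gamma> = frontier A" "l1_rectifiable \<gamma>"
    and \<alpha>: "0 \<le> \<alpha>" "\<alpha> < 1 / 2" "similar_to A (rect_R \<alpha>)"
  shows "measure lebesgue A = (l1_length \<gamma> / 4)\<^sup>2 - 4 * sq_dist2 A"
proof -
  obtain c1 c2 k1 k2 R where k: "0 < R" "\<bar>k1\<bar> = R" "\<bar>k2\<bar> = R"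
    and "A = axis_map c1 c2 k1 k2 ` rect_R \<alpha> \<or> A = axis_map c1 c2 k1 k2 ` prod.swap ` rect_R \<alpha>"
    using \<alpha>(3) by (rule similar_toD)
  then obtain u w where A: "A = axis_map c1 c2 k1 k2 ` ({0..u} \<times> {0..w})"
    and uw: "(u = 1 - 2 * \<alpha> \<and> w = 1 + 2 * \<alpha>) \<or> (u = 1 + 2 * \<alpha> \<and> w = 1 - 2 * \<alpha>)"
    unfolding rect_R_def swap_image_Times by blast
  have nn: "0 \<le> u" "0 \<le> w" "u + w = 2" "\<bar>w - u\<bar> = 4 * \<alpha>"
    using uw \<alpha> by auto
  have uw_prod: "u * w = 1 - 4 * \<alpha>\<^sup>2"
    using uw by (elim disjE conjE; hypsubst; simp add: power2_eq_square algebra_simps)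
  obtain p where p: "(\<lambda>x. k1 * x + c1) ` {0..u} = {p..p + \<bar>k1\<bar> * u}"
    using affine_image_interval_length[OF nn(1)] .
  obtain q where q: "(\<lambda>x. k2 * x + c2) ` {0..w} = {q..q + \<bar>k2\<bar> * w}"
    using affine_image_interval_length[OF nn(2)] .
  have "A = {p..p + R * u} \<times> {q..q + R * w}"
    unfolding A axis_map_image_Times p q k ..
  moreover have "0 \<le> R * u" "0 \<le> R * w" using nn k(1) by auto
  ultimately have tb: "tight_box A p (p + R * u) q (q + R * w)"
    by (auto simp: tight_box_def)
  show ?thesis
  proof (rule extremal_imp_equality[OF dom \<gamma> k(1) \<alpha>(1)])
    have "simple_path \<gamma>" using \<gamma>(1) by (simp add: jordan_curve_def)
    then have "l1_length \<gamma> \<le> R * (2 * u + 2 * w)"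
      using is_domain_props(1)[OF dom]
      by (intro axis_image_rect_length_le[OF _ \<gamma>(2) _ A k nn(1,2)] compact_imp_closed)
    also have "2 * u + 2 * w = 4" using nn(3) by linarith
    finally show "l1_length \<gamma> \<le> 4 * R" by simp
    have "measure lebesgue A = R\<^sup>2 * (u * w)"
      unfolding A measure_axis_image_rect(1)[OF nn(1,2)] k by (simp add: power2_eq_square)
    then show "measure lebesgue A = R\<^sup>2 * (1 - 4 * \<alpha>\<^sup>2)" using uw_prod by simp
    fix S l assume "is_square S" "0 \<le> l" "A \<subseteq> S + B_inf l" "S \<subseteq> A + B_inf l"
    then have "\<bar>R * w - R * u\<bar> \<le> 4 * l" using square_near_box[OF tb, of S l] by simp
    moreover have "\<bar>R * w - R * u\<bar> = R * (4 * \<alpha>)"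
      unfolding nn(4)[symmetric] using k(1) by (simp add: abs_mult flip: right_diff_distrib)
    ultimately show "R * \<alpha> \<le> l" by simp
  qed
qed

lemma similar_notched_equality:
  assumes dom: "is_domain A"
    and \<gamma>: "jordan_curve \<gamma>" "path_image \<gamma> = frontier A" "l1_rectifiable \<gamma>"
    and \<delta>: "0 \<le> \<delta>" "\<delta> < 1 / 2" "similar_to A (notched_square \<delta>)"
  shows "measure lebesgue A = (l1_length \<gamma> / 4)\<^sup>2 - 4 * sq_dist2 A"
proof -
  have "prod.swap ` notched_square \<delta> = notched_square \<delta>"
    unfolding notched_square_union[OF \<delta>(1,2)] image_Un swap_image_Times by (rule Un_commute)
  then obtain c1 c2 k1 k2 R where k: "0 < R" "\<bar>k1\<bar> = R" "\<bar>k2\<bar> = R"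
    and A: "A = axis_map c1 c2 k1 k2 ` notched_square \<delta>"
    using similar_toD[OF \<delta>(3)] by metis
  show ?thesis
  proof (rule extremal_imp_equality[OF dom \<gamma> k(1) \<delta>(1)])
    have "simple_path \<gamma>" using \<gamma>(1) by (simp add: jordan_curve_def)
    then show "l1_length \<gamma> \<le> 4 * R"
      using is_domain_props(1)[OF dom] axis_image_notched_length_le[OF _ \<gamma>(2) _ A k \<delta>(1,2)]
      by (simp add: compact_imp_closed mult.commute)
    show "measure lebesgue A = R\<^sup>2 * (1 - 4 * \<delta>\<^sup>2)"
      unfolding A by (rule measure_axis_image_notched[OF k(2,3,1) \<delta>(1,2)])
    show "R * \<delta> \<le> l" if "is_square S" "A \<subseteq> S + B_inf l" "S \<subseteq> A + B_inf l" for S l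
      by (rule square_near_notched[OF A k \<delta>(1,2) that])
  qed
qed

theorem mainTheorem2:
  fixes A :: "(real \<times> real) set" and \<gamma> :: "real \<Rightarrow> real \<times> real" and \<epsilon> :: real
  assumes "is_domain A"
    and "jordan_curve \<gamma>" and "path_image \<gamma> = frontier A" and "l1_rectifiable \<gamma>"
    and "(l1_length \<gamma>)\<^sup>2 = (16 + \<epsilon>) * measure lebesgue A"
  shows "(INF S\<in>{S. is_square S}. (d_inf A S)\<^sup>2) = \<epsilon> * measure lebesgue A / 64 \<longleftrightarrow>
    (\<exists>\<alpha>. 0 \<le> \<alpha> \<and> \<alpha> < 1 / 2 \<and> similar_to A (rect_R \<alpha>)) \<or>
    (\<exists>\<delta>. 0 \<le> \<delta> \<and> \<delta> < 1 / 2 \<and> similar_to A (notched_square \<delta>))"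
proof -
  have "\<epsilon> * measure lebesgue A = (l1_length \<gamma>)\<^sup>2 - 16 * measure lebesgue A"
    unfolding assms(5) by (simp add: algebra_simps)
  then have "sq_dist2 A = \<epsilon> * measure lebesgue A / 64 \<longleftrightarrow>
      measure lebesgue A = (l1_length \<gamma> / 4)\<^sup>2 - 4 * sq_dist2 A"
    by (auto simp: power_divide field_simps)
  then show ?thesis
    using equality_imp_extremal[OF assms(1-4)] similar_rect_equality[OF assms(1-4)]
      similar_notched_equality[OF assms(1-4)] by blast
qed

end
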